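(* Let $\Sigma$ be any subexponential signature, let $\Pi=A_1,\dots,A_k$ be a (possibly empty) sequence of formulae of $\mathrm{SMALC}_\Sigma$ and $B$ a formula of $\mathrm{SMALC}_\Sigma$. The following are equivalent: (1) $\Pi\to B$ is derivable in $\mathrm{SMALC}_\Sigma$; (2) $\Pi\to B$ is derivable in $\mathrm{SMALC}_\Sigma+(\mathrm{cut})$; (3) $\vdash\widehat{\Pi}^\bot,\widehat{B}$ is derivable in $\mathrm{SCLL}_\Sigma+(\mathrm{cut})$; (4) $\vdash\widehat{\Pi}^\bot,\widehat{B}$ is derivable in $\mathrm{SCLL}_\Sigma$.
   Context: A subexponential signature is a tuple $\Sigma = \langle \mathcal{I}, \preceq, \mathcal{W}, \mathcal{C}, \mathcal{E}\rangle$ where $\mathcal{I}$ is a finite set of labels, $\preceq$ is a preorder on $\mathcal{I}$, and $\mathcal{W},\mathcal{C},\mathcal{E}\subseteq\mathcal{I}$ are upwardly closed with respect to $\preceq$, and $\mathcal{W}\cap\mathcal{C}\subseteq\mathcal{E}$. The multiplicative-additive Lambek calculus with subexponentials, $\mathrm{SMALC}_\Sigma$. Formulae are built from variables $p_1,p_2,\dots$ and the constant $\mathbf{1}$ using binary connectives $\cdot$, $\backslash$, $/$, $\wedge$, $\vee$ and unary ${!}^s$ for $s\in\mathcal{I}$. Sequents are $\Gamma\to C$ with $\Gamma$ a finite, possibly empty, sequence of formulae. Axioms and rules (cut-free): (ax) $A\to A$; ($\to\mathbf{1}$) $\to\mathbf{1}$; ($\cdot\to$) from $\Gamma_1,A,B,\Gamma_2\to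 C$ infer $\Gamma_1,A\cdot B,\Gamma_2\to C$; ($\to\cdot$) from $\Gamma_1\to A$ and $\Gamma_2\to B$ infer $\Gamma_1,\Gamma_2\to A\cdot B$; ($\backslash\to$) from $\Pi\to A$ and $\Gamma_1,B,\Gamma_2\to C$ infer $\Gamma_1,\Pi,A\backslash B,\Gamma_2\to C$; ($\to\backslash$) from $A,\Pi\to B$ infer $\Pi\to A\backslash B$; ($/\to$) from $\Pi\to A$ and $\Gamma_1,B,\Gamma_2\to C$ infer $\Gamma_1,B/A,\Pi,\Gamma_2\to C$; ($\to/$) from $\Pi,A\to B$ infer $\Pi\to B/A$; ($\mathbf{1}\to$) from $\Gamma_1,\Gamma_2\to C$ infer $\Gamma_1,\mathbf{1},\Gamma_2\to C$; ($\vee\to$) from $\Gamma_1,A_1,\Gamma_2\to C$ and $\Gamma_1,A_2,\Gamma_2\to C$ infer $\Gamma_1,A_1\vee A_2,\Gamma_2\to C$; ($\to\vee$) from $\Gamma\to A_i$ infer $\Gamma\to A_1\vee A_2$ ($i=1,2$); ($\wedge\to$) from $\Gamma_1,A_i,\Gamma_2\to C$ infer $\Gamma_1,A_1\wedge A_2,\Gamma_2\to C$ ($i=1,2$); ($\to\wedge$) from $\Gamma\to A_1$ and $\Gamma\to A_2$ infer $\Gamma\to A_1\wedge A_2$; (${!}\to$) from $\Gamma_1,A,\Gamma_2\to C$ infer $\Gamma_1,{!}^sA,\Gamma_2\to C$; ($\to{!}$) from ${!}^{s_1}A_1,\dots,{!}^{s_n}A_n\to B$ infer ${!}^{s_1}A_1,\dots,{!}^{s_n}A_n\to{!}^sB$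 provided $s\preceq s_j$ for all $j$; (weak) for $s\in\mathcal{W}$: from $\Gamma_1,\Gamma_2\to C$ infer $\Gamma_1,{!}^sA,\Gamma_2\to C$; (ncontr) for $s\in\mathcal{C}$: from $\Gamma_1,{!}^sA,\Delta,{!}^sA,\Gamma_2\to C$ infer $\Gamma_1,{!}^sA,\Delta,\Gamma_2\to C$, and also infer $\Gamma_1,\Delta,{!}^sA,\Gamma_2\to C$; (ex) for $s\in\mathcal{E}$: from $\Gamma_1,\Delta,{!}^sA,\Gamma_2\to C$ infer $\Gamma_1,{!}^sA,\Delta,\Gamma_2\to C$, and from $\Gamma_1,{!}^sA,\Delta,\Gamma_2\to C$ infer $\Gamma_1,\Delta,{!}^sA,\Gamma_2\to C$. Cut: from $\Pi\to A$ and $\Gamma_1,A,\Gamma_2\to C$ infer $\Gamma_1,\Pi,\Gamma_2\to C$; $\mathrm{SMALC}_\Sigma+(\mathrm{cut})$ is the system with cut. Cyclic linear logic with subexponentials, $\mathrm{SCLL}_\Sigma$. Atoms are $p_i$ and $\bar p_i$; formulae are built from atoms and constants $\mathbf{1},\bot,\top,\mathbf{0}$ with $\otimes$, $\wp$ (par), $\mathbin{\&}$, $\oplus$, ${!}^s$, ${?}^s$ ($s\in\mathcal{I}$). Negation: $p_i^\bot=\bar p_i$, $\bar p_i^\bot=p_i$, $(A\otimes B)^\bot=B^\bot\wp A^\bot$, $(A\wp B)^\bot=B^\bot\otimes A^\bot$, $(A\oplus B)^\bot=A^\bot\mathbin{\&}B^\bot$, $(A\mathbin{\&}B)^\bot=A^\bot\oplus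 B^\bot$, $({!}^sA)^\bot={?}^sA^\bot$, $({?}^sA)^\bot={!}^sA^\bot$, $\mathbf{1}^\bot=\bot$, $\bot^\bot=\mathbf{1}$, $\mathbf{0}^\bot=\top$, $\top^\bot=\mathbf{0}$. Sequents $\vdash\Gamma$ with $\Gamma$ a nonempty cyclically ordered sequence ($\vdash\Gamma_1,\Gamma_2$ identified with $\vdash\Gamma_2,\Gamma_1$, no other permutations). Rules of cut-free $\mathrm{SCLL}_\Sigma$: (ax) $\vdash A,A^\bot$; ($\otimes$) from $\vdash\Gamma,A$ and $\vdash B,\Delta$ infer $\vdash\Gamma,A\otimes B,\Delta$; ($\wp$) from $\vdash A,B,\Gamma$ infer $\vdash A\wp B,\Gamma$; ($\mathbin{\&}$) from $\vdash A_1,\Gamma$ and $\vdash A_2,\Gamma$ infer $\vdash A_1\mathbin{\&}A_2,\Gamma$; ($\oplus$) from $\vdash A_i,\Gamma$ infer $\vdash A_1\oplus A_2,\Gamma$; ($\mathbf{1}$) $\vdash\mathbf{1}$; ($\bot$) from $\vdash\Gamma$ infer $\vdash\bot,\Gamma$; ($\top$) $\vdash\top,\Gamma$; (${!}$) from $\vdash B,{?}^{s_1}A_1,\dots,{?}^{s_n}A_n$ infer $\vdash{!}^sB,{?}^{s_1}A_1,\dots,{?}^{s_n}A_n$ provided $s\preceq s_j$ for all $j$; (${?}$) from $\vdash A,\Gamma$ infer $\vdash{?}^sA,\Gamma$; (weak) $s\in\mathcal{W}$: from $\vdash\Gamma$ infer $\vdash{?}^sA,\Gamma$; (ncontr) $s\in\mathcal{C}$: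 from $\vdash{?}^sA,\Gamma,{?}^sA,\Delta$ infer $\vdash{?}^sA,\Gamma,\Delta$; (ex) $s\in\mathcal{E}$: from $\vdash\Gamma,{?}^sA,\Delta$ infer $\vdash{?}^sA,\Gamma,\Delta$. No rule for $\mathbf{0}$. Cut: from $\vdash\Gamma,A^\bot$ and $\vdash A,\Delta$ infer $\vdash\Gamma,\Delta$. Translation: $\widehat{p_i}=p_i$, $\widehat{\mathbf{1}}=\mathbf{1}$, $\widehat{A\cdot B}=\widehat A\otimes\widehat B$, $\widehat{A\backslash B}=\widehat A^\bot\wp\widehat B$, $\widehat{B/A}=\widehat B\wp\widehat A^\bot$, $\widehat{A\wedge B}=\widehat A\mathbin{\&}\widehat B$, $\widehat{A\vee B}=\widehat A\oplus\widehat B$, $\widehat{{!}^sA}={!}^s\widehat A$. For $\Pi=A_1,\dots,A_k$, $\widehat\Pi^\bot$ denotes the sequence $\widehat{A_k}^\bot,\dots,\widehat{A_1}^\bot$. *)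

theory Defs
  imports Main
begin

record 's subexp_sig =
  labels :: "'s set"
  label_le :: "('s \<times> 's) set"
  weak_labels :: "'s set"
  contr_labels :: "'s set"
  exch_labels :: "'s set"

definition up_closed :: "('s \<times> 's) set \<Rightarrow> 's set \<Rightarrow> bool" where
  "up_closed r X \<longleftrightarrow> (\<forall>s t. s \<in> X \<longrightarrow> (s, t) \<in> r \<longrightarrow> t \<in> X)"

definition subexp_signature :: "'s subexp_sig \<Rightarrow> bool" where
  "subexp_signature S \<longleftrightarrow>
     finite (labels S) \<and>
     preorder_on (labels S) (label_le S) \<and>
     weak_labels S \<subseteq> labels S \<and>
     contr_labels S \<subseteq> labels S \<and>
     exch_labels S \<subseteq> labels S \<and>
     up_closed (label_le S) (weak_labels S) \<and>
     up_closed (label_le S) (contr_labels S) \<and>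
     up_closed (label_le S) (exch_labels S) \<and>
     weak_labels S \<inter> contr_labels S \<subseteq> exch_labels S"


section \<open>The multiplicative-additive Lambek calculus with subexponentials\<close>

text \<open>\<open>Under A B\<close> is \<open>A \ B\<close>, and \<open>Over B A\<close> is \<open>B / A\<close>.\<close>

datatype (smalc_labels: 's) smalc_fm =
    Var nat
  | Unit
  | Dot "'s smalc_fm" "'s smalc_fm"
  | Under "'s smalc_fm" "'s smalc_fm"
  | Over "'s smalc_fm" "'s smalc_fm"
  | Meet "'s smalc_fm" "'s smalc_fm"
  | Join "'s smalc_fm" "'s smalc_fm"
  | Bang 's "'s smalc_fm"

definition smalc_fms :: "'s subexp_sig \<Rightarrow> 's smalc_fm set" where
  "smalc_fms S = {A. smalc_labels A \<subseteq> labels S}"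

text \<open>The flag \<open>c\<close> tells whether the cut rule is available. The side conditions mentioning
  \<^const>\<open>smalc_fms\<close> and \<^const>\<open>labels\<close> are placed so that every derivable sequent, hence also
  every cut formula, consists of formulae over the signature.\<close>

inductive smalc_derivable ::
  "'s subexp_sig \<Rightarrow> bool \<Rightarrow> 's smalc_fm list \<Rightarrow> 's smalc_fm \<Rightarrow> bool"
  for S :: "'s subexp_sig" and c :: bool where
  ax: "A \<in> smalc_fms S \<Longrightarrow> smalc_derivable S c [A] A"
| unit_right: "smalc_derivable S c [] Unit"
| dot_left: "smalc_derivable S c (\<Gamma>1 @ [A, B] @ \<Gamma>2) C \<Longrightarrow>
    smalc_derivable S c (\<Gamma>1 @ [Dot A B] @ \<Gamma>2) C"
| dot_right: "smalc_derivable S c \<Gamma>1 A \<Longrightarrow> smalc_derivable S c \<Gamma>2 B \<Longrightarrow>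
    smalc_derivable S c (\<Gamma>1 @ \<Gamma>2) (Dot A B)"
| under_left: "smalc_derivable S c \<Theta> A \<Longrightarrow> smalc_derivable S c (\<Gamma>1 @ [B] @ \<Gamma>2) C \<Longrightarrow>
    smalc_derivable S c (\<Gamma>1 @ \<Theta> @ [Under A B] @ \<Gamma>2) C"
| under_right: "smalc_derivable S c ([A] @ \<Theta>) B \<Longrightarrow> smalc_derivable S c \<Theta> (Under A B)"
| over_left: "smalc_derivable S c \<Theta> A \<Longrightarrow> smalc_derivable S c (\<Gamma>1 @ [B] @ \<Gamma>2) C \<Longrightarrow>
    smalc_derivable S c (\<Gamma>1 @ [Over B A] @ \<Theta> @ \<Gamma>2) C"
| over_right: "smalc_derivable S c (\<Theta> @ [A]) B \<Longrightarrow> smalc_derivable S c \<Theta> (Over B A)"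
| unit_left: "smalc_derivable S c (\<Gamma>1 @ \<Gamma>2) C \<Longrightarrow>
    smalc_derivable S c (\<Gamma>1 @ [Unit] @ \<Gamma>2) C"
| join_left: "smalc_derivable S c (\<Gamma>1 @ [A1] @ \<Gamma>2) C \<Longrightarrow>
    smalc_derivable S c (\<Gamma>1 @ [A2] @ \<Gamma>2) C \<Longrightarrow>
    smalc_derivable S c (\<Gamma>1 @ [Join A1 A2] @ \<Gamma>2) C"
| join_right1: "smalc_derivable S c \<Gamma> A1 \<Longrightarrow> A2 \<in> smalc_fms S \<Longrightarrow>
    smalc_derivable S c \<Gamma> (Join A1 A2)"
| join_right2: "smalc_derivable S c \<Gamma> A2 \<Longrightarrow> A1 \<in> smalc_fms S \<Longrightarrow>
    smalc_derivable S c \<Gamma> (Join A1 A2)"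
| meet_left1: "smalc_derivable S c (\<Gamma>1 @ [A1] @ \<Gamma>2) C \<Longrightarrow> A2 \<in> smalc_fms S \<Longrightarrow>
    smalc_derivable S c (\<Gamma>1 @ [Meet A1 A2] @ \<Gamma>2) C"
| meet_left2: "smalc_derivable S c (\<Gamma>1 @ [A2] @ \<Gamma>2) C \<Longrightarrow> A1 \<in> smalc_fms S \<Longrightarrow>
    smalc_derivable S c (\<Gamma>1 @ [Meet A1 A2] @ \<Gamma>2) C"
| meet_right: "smalc_derivable S c \<Gamma> A1 \<Longrightarrow> smalc_derivable S c \<Gamma> A2 \<Longrightarrow>
    smalc_derivable S c \<Gamma> (Meet A1 A2)"
| bang_left: "smalc_derivable S c (\<Gamma>1 @ [A] @ \<Gamma>2) C \<Longrightarrow> s \<in> labels S \<Longrightarrow>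
    smalc_derivable S c (\<Gamma>1 @ [Bang s A] @ \<Gamma>2) C"
| bang_right: "smalc_derivable S c (map (\<lambda>(t, A). Bang t A) tAs) B \<Longrightarrow> s \<in> labels S \<Longrightarrow>
    \<forall>(t, A) \<in> set tAs. (s, t) \<in> label_le S \<Longrightarrow>
    smalc_derivable S c (map (\<lambda>(t, A). Bang t A) tAs) (Bang s B)"
| weak: "smalc_derivable S c (\<Gamma>1 @ \<Gamma>2) C \<Longrightarrow> s \<in> weak_labels S \<Longrightarrow> A \<in> smalc_fms S \<Longrightarrow>
    smalc_derivable S c (\<Gamma>1 @ [Bang s A] @ \<Gamma>2) C"
| ncontr1: "smalc_derivable S c (\<Gamma>1 @ [Bang s A] @ \<Delta> @ [Bang s A] @ \<Gamma>2) C \<Longrightarrow>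
    s \<in> contr_labels S \<Longrightarrow> smalc_derivable S c (\<Gamma>1 @ [Bang s A] @ \<Delta> @ \<Gamma>2) C"
| ncontr2: "smalc_derivable S c (\<Gamma>1 @ [Bang s A] @ \<Delta> @ [Bang s A] @ \<Gamma>2) C \<Longrightarrow>
    s \<in> contr_labels S \<Longrightarrow> smalc_derivable S c (\<Gamma>1 @ \<Delta> @ [Bang s A] @ \<Gamma>2) C"
| ex1: "smalc_derivable S c (\<Gamma>1 @ \<Delta> @ [Bang s A] @ \<Gamma>2) C \<Longrightarrow>
    s \<in> exch_labels S \<Longrightarrow> smalc_derivable S c (\<Gamma>1 @ [Bang s A] @ \<Delta> @ \<Gamma>2) C"
| ex2: "smalc_derivable S c (\<Gamma>1 @ [Bang s A] @ \<Delta> @ \<Gamma>2) C \<Longrightarrow>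
    s \<in> exch_labels S \<Longrightarrow> smalc_derivable S c (\<Gamma>1 @ \<Delta> @ [Bang s A] @ \<Gamma>2) C"
| cut: "c \<Longrightarrow> smalc_derivable S c \<Theta> A \<Longrightarrow> smalc_derivable S c (\<Gamma>1 @ [A] @ \<Gamma>2) C \<Longrightarrow>
    smalc_derivable S c (\<Gamma>1 @ \<Theta> @ \<Gamma>2) C"

abbreviation SMALC :: "'s subexp_sig \<Rightarrow> 's smalc_fm list \<Rightarrow> 's smalc_fm \<Rightarrow> bool" where
  "SMALC S \<equiv> smalc_derivable S False"

abbreviation SMALC_cut :: "'s subexp_sig \<Rightarrow> 's smalc_fm list \<Rightarrow> 's smalc_fm \<Rightarrow> bool" where
  "SMALC_cut S \<equiv> smalc_derivable S True"


section \<open>Cyclic linear logic with subexponentials\<close>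

datatype (scll_labels: 's) scll_fm =
    Atom nat
  | NAtom nat
  | One
  | Bot
  | Top
  | Zero
  | Tensor "'s scll_fm" "'s scll_fm"
  | Par "'s scll_fm" "'s scll_fm"
  | With "'s scll_fm" "'s scll_fm"
  | Plus "'s scll_fm" "'s scll_fm"
  | OfCourse 's "'s scll_fm"
  | WhyNot 's "'s scll_fm"

definition scll_fms :: "'s subexp_sig \<Rightarrow> 's scll_fm set" where
  "scll_fms S = {A. scll_labels A \<subseteq> labels S}"

primrec neg :: "'s scll_fm \<Rightarrow> 's scll_fm" where
  "neg (Atom i) = NAtom i"
| "neg (NAtom i) = Atom i"
| "neg One = Bot"
| "neg Bot = One"
| "neg Top = Zero"
| "neg Zero = Top"
| "neg (Tensor A B) = Par (neg B) (neg A)"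
| "neg (Par A B) = Tensor (neg B) (neg A)"
| "neg (With A B) = Plus (neg A) (neg B)"
| "neg (Plus A B) = With (neg A) (neg B)"
| "neg (OfCourse s A) = WhyNot s (neg A)"
| "neg (WhyNot s A) = OfCourse s (neg A)"

text \<open>A cyclically ordered sequent is represented by any of the lists obtained by cutting the
  cycle open; the rule \<open>rotate\<close> expresses the identification of these lists. Sequents are
  nonempty; only \<open>cut\<close> needs a side condition to this effect, since all other rules have nonempty
  conclusions when their premises are nonempty.\<close>

inductive scll_derivable :: "'s subexp_sig \<Rightarrow> bool \<Rightarrow> 's scll_fm list \<Rightarrow> bool"
  for S :: "'s subexp_sig" and c :: bool where
  rotate: "scll_derivable S c (\<Gamma>1 @ \<Gamma>2) \<Longrightarrow> scll_derivable S c (\<Gamma>2 @ \<Gamma>1)"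
| ax: "A \<in> scll_fms S \<Longrightarrow> scll_derivable S c [A, neg A]"
| tensor: "scll_derivable S c (\<Gamma> @ [A]) \<Longrightarrow> scll_derivable S c ([B] @ \<Delta>) \<Longrightarrow>
    scll_derivable S c (\<Gamma> @ [Tensor A B] @ \<Delta>)"
| par: "scll_derivable S c ([A, B] @ \<Gamma>) \<Longrightarrow> scll_derivable S c ([Par A B] @ \<Gamma>)"
| with_rule: "scll_derivable S c ([A1] @ \<Gamma>) \<Longrightarrow> scll_derivable S c ([A2] @ \<Gamma>) \<Longrightarrow>
    scll_derivable S c ([With A1 A2] @ \<Gamma>)"
| plus1: "scll_derivable S c ([A1] @ \<Gamma>) \<Longrightarrow> A2 \<in> scll_fms S \<Longrightarrow>
    scll_derivable S c ([Plus A1 A2] @ \<Gamma>)"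
| plus2: "scll_derivable S c ([A2] @ \<Gamma>) \<Longrightarrow> A1 \<in> scll_fms S \<Longrightarrow>
    scll_derivable S c ([Plus A1 A2] @ \<Gamma>)"
| one: "scll_derivable S c [One]"
| bot: "scll_derivable S c \<Gamma> \<Longrightarrow> scll_derivable S c ([Bot] @ \<Gamma>)"
| top: "set \<Gamma> \<subseteq> scll_fms S \<Longrightarrow> scll_derivable S c ([Top] @ \<Gamma>)"
| ofcourse: "scll_derivable S c ([B] @ map (\<lambda>(t, A). WhyNot t A) tAs) \<Longrightarrow> s \<in> labels S \<Longrightarrow>
    \<forall>(t, A) \<in> set tAs. (s, t) \<in> label_le S \<Longrightarrow>
    scll_derivable S c ([OfCourse s B] @ map (\<lambda>(t, A). WhyNot t A) tAs)"
| whynot: "scll_derivable S c ([A] @ \<Gamma>) \<Longrightarrow> s \<in> labels S \<Longrightarrow>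
    scll_derivable S c ([WhyNot s A] @ \<Gamma>)"
| weak: "scll_derivable S c \<Gamma> \<Longrightarrow> s \<in> weak_labels S \<Longrightarrow> A \<in> scll_fms S \<Longrightarrow>
    scll_derivable S c ([WhyNot s A] @ \<Gamma>)"
| ncontr: "scll_derivable S c ([WhyNot s A] @ \<Gamma> @ [WhyNot s A] @ \<Delta>) \<Longrightarrow>
    s \<in> contr_labels S \<Longrightarrow> scll_derivable S c ([WhyNot s A] @ \<Gamma> @ \<Delta>)"
| ex: "scll_derivable S c (\<Gamma> @ [WhyNot s A] @ \<Delta>) \<Longrightarrow>
    s \<in> exch_labels S \<Longrightarrow> scll_derivable S c ([WhyNot s A] @ \<Gamma> @ \<Delta>)"
| cut: "c \<Longrightarrow> scll_derivable S c (\<Gamma> @ [neg A]) \<Longrightarrow> scll_derivable S c ([A] @ \<Delta>) \<Longrightarrow>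
    \<Gamma> @ \<Delta> \<noteq> [] \<Longrightarrow> scll_derivable S c (\<Gamma> @ \<Delta>)"

abbreviation SCLL :: "'s subexp_sig \<Rightarrow> 's scll_fm list \<Rightarrow> bool" where
  "SCLL S \<equiv> scll_derivable S False"

abbreviation SCLL_cut :: "'s subexp_sig \<Rightarrow> 's scll_fm list \<Rightarrow> bool" where
  "SCLL_cut S \<equiv> scll_derivable S True"


section \<open>The translation\<close>

primrec hat :: "'s smalc_fm \<Rightarrow> 's scll_fm" where
  "hat (Var i) = Atom i"
| "hat Unit = One"
| "hat (Dot A B) = Tensor (hat A) (hat B)"
| "hat (Under A B) = Par (neg (hat A)) (hat B)"
| "hat (Over B A) = Par (hat B) (neg (hat A))"
| "hat (Meet A B) = With (hat A) (hat B)"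
| "hat (Join A B) = Plus (hat A) (hat B)"
| "hat (Bang s A) = OfCourse s (hat A)"

definition neg_hat_seq :: "'s smalc_fm list \<Rightarrow> 's scll_fm list" where
  "neg_hat_seq As = rev (map (\<lambda>A. neg (hat A)) As)"

end

theory Submission
  imports Defs
begin

text \<open>Cut elimination for cyclic linear logic is semantic, in the style of Okada. Lists of formulae
  form a phase space whose pole is the set of cut-free derivable sequents, and the fact interpreting
  \<open>!\<^sup>s A\<close> is generated by those lists in the interpretation of \<open>A\<close> that consist of formulae
  \<open>?\<^sup>t B\<close> with \<open>t\<close> above \<open>s\<close>; such lists inherit the structural rules of \<open>s\<close> because the sets
  of labels are upward closed. All rules including cut are sound for this interpretation, and every
  \<open>\<Gamma>\<close> in the interpretation of \<open>A\<close> makes \<open>\<Gamma>, A\<close> cut-free derivable.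

  A cut-free proof of a translated sequent contains only formulae \<open>hat A\<close> and \<open>neg (hat A)\<close>, and
  a count shows that each of its sequents has exactly one formula of the first kind. Opening the
  cycle at this formula turns the proof into one in the Lambek calculus.\<close>

section \<open>Negation, and formulae over the signature\<close>

lemma neg_neg [simp]: "neg (neg A) = A"
  by (induction A) auto

lemma scll_labels_neg [simp]: "scll_labels (neg A) = scll_labels A"
  by (induction A) auto

lemma scll_labels_hat [simp]: "scll_labels (hat A) = smalc_labels A"
  by (induction A) auto

lemma neg_in_scll_fms [simp]: "neg A \<in> scll_fms S \<longleftrightarrow> A \<in> scll_fms S"
  by (simp add: scll_fms_def)

lemma hat_in_scll_fms [simp]: "hat A \<in> scll_fms S \<longleftrightarrow> A \<in> smalc_fms S"
  by (simp add: scll_fms_def smalc_fms_def)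

lemma scll_fms_simps [simp]:
  "One \<in> scll_fms S" "Bot \<in> scll_fms S" "Top \<in> scll_fms S" "Zero \<in> scll_fms S"
  "Tensor A B \<in> scll_fms S \<longleftrightarrow> A \<in> scll_fms S \<and> B \<in> scll_fms S"
  "Par A B \<in> scll_fms S \<longleftrightarrow> A \<in> scll_fms S \<and> B \<in> scll_fms S"
  "With A B \<in> scll_fms S \<longleftrightarrow> A \<in> scll_fms S \<and> B \<in> scll_fms S"
  "Plus A B \<in> scll_fms S \<longleftrightarrow> A \<in> scll_fms S \<and> B \<in> scll_fms S"
  "OfCourse s A \<in> scll_fms S \<longleftrightarrow> s \<in> labels S \<and> A \<in> scll_fms S"
  "WhyNot s A \<in> scll_fms S \<longleftrightarrow> s \<in> labels S \<and> A \<in> scll_fms S"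
  by (auto simp: scll_fms_def)

lemma smalc_fms_simps [simp]:
  "Dot A B \<in> smalc_fms S \<longleftrightarrow> A \<in> smalc_fms S \<and> B \<in> smalc_fms S"
  "Under A B \<in> smalc_fms S \<longleftrightarrow> A \<in> smalc_fms S \<and> B \<in> smalc_fms S"
  "Over A B \<in> smalc_fms S \<longleftrightarrow> A \<in> smalc_fms S \<and> B \<in> smalc_fms S"
  "Meet A B \<in> smalc_fms S \<longleftrightarrow> A \<in> smalc_fms S \<and> B \<in> smalc_fms S"
  "Join A B \<in> smalc_fms S \<longleftrightarrow> A \<in> smalc_fms S \<and> B \<in> smalc_fms S"
  "Bang s A \<in> smalc_fms S \<longleftrightarrow> s \<in> labels S \<and> A \<in> smalc_fms S"
  by (auto simp: smalc_fms_def)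

lemma neg_hat_seq_simps [simp]:
  "neg_hat_seq [] = []"
  "neg_hat_seq (\<Gamma> @ \<Delta>) = neg_hat_seq \<Delta> @ neg_hat_seq \<Gamma>"
  "neg_hat_seq (A # \<Gamma>) = neg_hat_seq \<Gamma> @ [neg (hat A)]"
  by (simp_all add: neg_hat_seq_def)

lemma scll_rotate_iff: "scll_derivable S c (\<Gamma> @ \<Delta>) \<longleftrightarrow> scll_derivable S c (\<Delta> @ \<Gamma>)"
  by (blast intro: scll_derivable.rotate)

text \<open>The side conditions of the rules keep foreign formulae out. Weakening draws on the
  signature itself, through \<open>weak_labels S \<subseteq> labels S\<close>.\<close>

lemma scll_derivable_fms:
  assumes "subexp_signature S" "scll_derivable S c \<Gamma>"
  shows "set \<Gamma> \<subseteq> scll_fms S"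
  using assms(2)
proof (induction rule: scll_derivable.induct)
  case (weak \<Gamma> s A)
  then show ?case using assms(1) by (auto simp: subexp_signature_def)
qed auto

subsection \<open>Phase semantics and cut elimination\<close>

text \<open>Rotation makes left and right orthogonals coincide, so one operation suffices although
  concatenation is not commutative.\<close>

definition orth :: "'s subexp_sig \<Rightarrow> 's scll_fm list set \<Rightarrow> 's scll_fm list set" where
  "orth S X = {y. \<forall>x\<in>X. SCLL S (x @ y)}"

definition conc :: "'a list set \<Rightarrow> 'a list set \<Rightarrow> 'a list set" where
  "conc X Y = {x @ y | x y. x \<in> X \<and> y \<in> Y}"

text \<open>The analogue of the submonoid that interprets exponentials in phase semantics: it is
  closed under concatenation and shrinks as the label goes up.\<close>

definition whynot_ctxts :: "'s subexp_sig \<Rightarrow> 's \<Rightarrow> 's scll_fm list set" where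
  "whynot_ctxts S s = lists {WhyNot t A | t A. (s, t) \<in> label_le S \<and> t \<in> labels S \<and> A \<in> scll_fms S}"

text \<open>\<open>\<Gamma> \<in> interp S A\<close> is meant to entail that \<open>\<Gamma>, A\<close> is cut-free derivable; since this
  puts \<open>\<Gamma>\<close> on the negated side, the tensor product reverses the order.\<close>

primrec interp :: "'s subexp_sig \<Rightarrow> 's scll_fm \<Rightarrow> 's scll_fm list set" where
  "interp S (Atom i) = orth S {[Atom i]}"
| "interp S (NAtom i) = orth S (orth S {[Atom i]})"
| "interp S One = orth S (orth S {[]})"
| "interp S Bot = orth S {[]}"
| "interp S Top = orth S {[Top]}"
| "interp S Zero = orth S (orth S {[Top]})"
| "interp S (Tensor A B) = orth S (orth S (conc (interp S B) (interp S A)))"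
| "interp S (Par A B) = orth S (conc (orth S (interp S A)) (orth S (interp S B)))"
| "interp S (With A B) = interp S A \<inter> interp S B"
| "interp S (Plus A B) = orth S (orth S (interp S A \<union> interp S B))"
| "interp S (OfCourse s A) = orth S (orth S (whynot_ctxts S s \<inter> interp S A))"
| "interp S (WhyNot s A) = orth S (whynot_ctxts S s \<inter> orth S (interp S A))"

section \<open>Facts and the Galois connection of \<open>orth\<close>\<close>

lemma concI: "x \<in> X \<Longrightarrow> y \<in> Y \<Longrightarrow> x @ y \<in> conc X Y"
  by (auto simp: conc_def)

lemma orth_antimono: "X \<subseteq> Y \<Longrightarrow> orth S Y \<subseteq> orth S X"
  by (auto simp: orth_def)

text \<open>The lists \<open>x @ y\<close> and \<open>y @ x\<close> represent the same cycle, so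
  orthogonality is a symmetric relation.\<close>

lemma orth_sym: "X \<subseteq> orth S Y \<longleftrightarrow> Y \<subseteq> orth S X"
  using scll_rotate_iff[of S False] by (auto simp: orth_def)

lemma subset_biorth: "X \<subseteq> orth S (orth S X)"
  using orth_sym by blast

lemma orth_orth_orth [simp]: "orth S (orth S (orth S X)) = orth S X"
  by (simp add: orth_antimono subset_antisym subset_biorth)

lemma orth_Un: "orth S (X \<union> Y) = orth S X \<inter> orth S Y"
  by (auto simp: orth_def)

lemma biorth_least: "X \<subseteq> orth S Y \<Longrightarrow> orth S (orth S X) \<subseteq> orth S Y"
  by (metis orth_sym orth_antimono)

text \<open>Every interpretation is a fact. Only \<open>With\<close> is not an orthogonal by
  definition, but an intersection of facts is the orthogonal of the union of their
  orthogonals.\<close>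

lemma biorth_interp [simp]: "orth S (orth S (interp S A)) = interp S A"
proof (induction A)
  case (With A B)
  then have "interp S (With A B) = orth S (orth S (interp S A) \<union> orth S (interp S B))"
    by (simp add: orth_Un)
  then show ?case by (metis orth_orth_orth)
qed auto

text \<open>De Morgan duality. The swap of factors in the interpretation of \<open>Tensor\<close>
  matches the swap that \<open>neg\<close> performs between \<open>Tensor\<close> and
  \<open>Par\<close>.\<close>

lemma interp_neg: "interp S (neg A) = orth S (interp S A)"
proof (induction A)
  case (With A B)
  then have "interp S (With A B) = orth S (orth S (interp S A) \<union> orth S (interp S B))"
    by (simp add: orth_Un)
  with With show ?case by simp
next
  case (Plus A B)
  then show ?case by (simp flip: orth_Un)
qed auto

text \<open>An element of a closure may be replaced by a generator when derivability is tested. Most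
  cases of soundness rest on this.\<close>

lemma biorth_cut:
  assumes "x \<in> orth S (orth S X)" "\<And>x. x \<in> X \<Longrightarrow> SCLL S (x @ y)"
  shows "SCLL S (x @ y)"
proof -
  have "y \<in> orth S X" using assms(2) by (simp add: orth_def)
  then have "SCLL S (y @ x)" using assms(1) by (simp add: orth_def)
  then show ?thesis by (rule scll_derivable.rotate)
qed

lemma in_interpI:
  assumes "\<And>y. y \<in> orth S (interp S A) \<Longrightarrow> SCLL S (y @ x)"
  shows "x \<in> interp S A"
proof -
  have "x \<in> orth S (orth S (interp S A))" using assms unfolding orth_def[of S "orth S _"] by blast
  then show ?thesis by simp
qed

lemma in_orth_singleton: "y \<in> orth S {x} \<longleftrightarrow> SCLL S (x @ y)"
  by (simp add: orth_def)

lemma subset_orth_singletonI: "(\<And>x. x \<in> X \<Longrightarrow> SCLL S (y @ x)) \<Longrightarrow> X \<subseteq> orth S {y}"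
  by (auto simp: orth_def)

lemma subset_orth_singletonD: "X \<subseteq> orth S {y} \<Longrightarrow> x \<in> X \<Longrightarrow> SCLL S (y @ x)"
  by (auto simp: orth_def)

lemma whynot_ctxts_iff:
  "\<Gamma> \<in> whynot_ctxts S s \<longleftrightarrow> (\<exists>tAs. \<Gamma> = map (\<lambda>(t, A). WhyNot t A) tAs \<and>
     (\<forall>(t, A) \<in> set tAs. (s, t) \<in> label_le S \<and> t \<in> labels S \<and> A \<in> scll_fms S))"
proof
  show "\<Gamma> \<in> whynot_ctxts S s \<Longrightarrow> \<exists>tAs. \<Gamma> = map (\<lambda>(t, A). WhyNot t A) tAs \<and>
     (\<forall>(t, A) \<in> set tAs. (s, t) \<in> label_le S \<and> t \<in> labels S \<and> A \<in> scll_fms S)"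
  proof (induction \<Gamma>)
    case (Cons F \<Gamma>)
    then obtain t A tAs where "F = WhyNot t A" "(s, t) \<in> label_le S" "t \<in> labels S"
      "A \<in> scll_fms S" "\<Gamma> = map (\<lambda>(t, A). WhyNot t A) tAs"
      "\<forall>(t, A) \<in> set tAs. (s, t) \<in> label_le S \<and> t \<in> labels S \<and> A \<in> scll_fms S"
      by (auto simp: whynot_ctxts_def)
    then show ?case by (intro exI[of _ "(t, A) # tAs"]) auto
  qed auto
qed (fastforce simp: whynot_ctxts_def)

lemma whynot_ctxts_mono:
  assumes "(s, t) \<in> label_le S" "trans (label_le S)"
  shows "whynot_ctxts S t \<subseteq> whynot_ctxts S s"
  unfolding whynot_ctxts_def using assms by (intro lists_mono) (blast dest: transD)

text \<open>Adequacy. The target is a fact, so for interpretations that are closures only the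
  generators are checked, and for them the cut-free rule of the connective (for negated atoms and
  \<open>Zero\<close>, the axiom) gives the claim.\<close>

lemma interp_subset_orth:
  assumes S: "subexp_signature S"
  shows "A \<in> scll_fms S \<Longrightarrow> interp S A \<subseteq> orth S {[A]}"
proof (induction A)
  case (Atom i)
  then show ?case by simp
next
  case (NAtom i)
  have "SCLL S ([Atom i, neg (Atom i)])" using scll_derivable.ax[of "Atom i" S]
    by (auto simp: scll_fms_def)
  then have "SCLL S ([NAtom i] @ [Atom i])" using scll_rotate_iff[of S False "[Atom i]" "[NAtom i]"] by simp
  then have "{[Atom i]} \<subseteq> orth S {[NAtom i]}" by (simp add: orth_def)
  then show ?case by (simp add: biorth_least)
next
  case One
  have "{[]} \<subseteq> orth S {[One]}" by (simp add: orth_def scll_derivable.one)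
  then show ?case by (simp add: biorth_least)
next
  case Bot
  show ?case using scll_derivable.bot[of S False] by (auto simp: orth_def)
next
  case Top
  show ?case by simp
next
  case Zero
  have "SCLL S ([Zero] @ [Top])" using scll_derivable.ax[of Zero S] by simp
  then have "{[Top]} \<subseteq> orth S {[Zero]}" by (simp add: orth_def)
  then show ?case by (simp add: biorth_least)
next
  case (Tensor A B)
  then have AB: "interp S A \<subseteq> orth S {[A]}" "interp S B \<subseteq> orth S {[B]}" by simp_all
  have "conc (interp S B) (interp S A) \<subseteq> orth S {[Tensor A B]}"
  proof
    fix z assume "z \<in> conc (interp S B) (interp S A)"
    then obtain x y where z: "z = y @ x" and x: "x \<in> interp S A" and y: "y \<in> interp S B"
      by (auto simp: conc_def)
    have "SCLL S ([A] @ x)" "SCLL S ([B] @ y)"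
      by (rule subset_orth_singletonD[OF AB(1) x], rule subset_orth_singletonD[OF AB(2) y])
    then have "SCLL S (x @ [Tensor A B] @ y)"
      by (intro scll_derivable.tensor) (rule scll_derivable.rotate)
    then have "SCLL S (([Tensor A B] @ y) @ x)" by (rule scll_derivable.rotate)
    then show "z \<in> orth S {[Tensor A B]}" by (simp add: in_orth_singleton z)
  qed
  then show ?case by (simp add: biorth_least)
next
  case (Par A B)
  \<comment> \<open>By symmetry of \<open>orth\<close>, the induction hypotheses say that the
    one-element lists are refutations.\<close>
  then have "[A] \<in> orth S (interp S A)" "[B] \<in> orth S (interp S B)"
    using orth_sym[of "{_}" S] by auto
  then have "{[A, B]} \<subseteq> conc (orth S (interp S A)) (orth S (interp S B))"
    using concI[of "[A]" _ "[B]"] by simp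
  then have "interp S (Par A B) \<subseteq> orth S {[A, B]}" by (simp add: orth_antimono)
  moreover have "orth S {[A, B]} \<subseteq> orth S {[Par A B]}"
    using scll_derivable.par[of S False] by (auto simp: orth_def)
  ultimately show ?case by blast
next
  case (With A B)
  then have AB: "interp S A \<subseteq> orth S {[A]}" "interp S B \<subseteq> orth S {[B]}" by simp_all
  show ?case
    by (intro subset_orth_singletonI scll_derivable.with_rule
        subset_orth_singletonD[OF AB(1)] subset_orth_singletonD[OF AB(2)]) simp_all
next
  case (Plus A B)
  then have AB: "interp S A \<subseteq> orth S {[A]}" "interp S B \<subseteq> orth S {[B]}"
    "A \<in> scll_fms S" "B \<in> scll_fms S" by simp_all
  have "interp S A \<subseteq> orth S {[Plus A B]}" "interp S B \<subseteq> orth S {[Plus A B]}"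
    by (intro subset_orth_singletonI scll_derivable.plus1 subset_orth_singletonD[OF AB(1)] AB(4),
      assumption,
      intro subset_orth_singletonI scll_derivable.plus2 subset_orth_singletonD[OF AB(2)] AB(3))
  then show ?case by (simp add: biorth_least)
next
  case (OfCourse s A)
  then have A: "interp S A \<subseteq> orth S {[A]}" by simp
  have "whynot_ctxts S s \<inter> interp S A \<subseteq> orth S {[OfCourse s A]}"
  proof
    fix x assume x: "x \<in> whynot_ctxts S s \<inter> interp S A"
    then have "SCLL S ([A] @ x)" using subset_orth_singletonD[OF A] by blast
    moreover obtain tAs where "x = map (\<lambda>(t, A). WhyNot t A) tAs"
      "\<forall>(t, A) \<in> set tAs. (s, t) \<in> label_le S"
      using x by (fastforce simp: whynot_ctxts_iff)
    ultimately have "SCLL S ([OfCourse s A] @ x)"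
      using OfCourse.prems scll_derivable.ofcourse by auto
    then show "x \<in> orth S {[OfCourse s A]}" by (simp add: in_orth_singleton)
  qed
  then show ?case by (simp add: biorth_least)
next
  case (WhyNot s A)
  then have A: "interp S A \<subseteq> orth S {[A]}" and s: "s \<in> labels S" by simp_all
  \<comment> \<open>Reflexivity makes the one-element list \<open>[WhyNot s A]\<close> a context for
    \<open>s\<close> itself.\<close>
  have "(s, s) \<in> label_le S"
    using S WhyNot.prems by (auto simp: subexp_signature_def preorder_on_def refl_on_def)
  then have "[WhyNot s A] \<in> whynot_ctxts S s"
    using WhyNot.prems by (simp add: whynot_ctxts_def)
  moreover have "interp S A \<subseteq> orth S {[WhyNot s A]}"
    by (intro subset_orth_singletonI scll_derivable.whynot subset_orth_singletonD[OF A] s)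
  then have "[WhyNot s A] \<in> orth S (interp S A)" using orth_sym by blast
  ultimately have "{[WhyNot s A]} \<subseteq> whynot_ctxts S s \<inter> orth S (interp S A)" by blast
  then show ?case by (simp add: orth_antimono)
qed

section \<open>Soundness of all rules for the phase interpretation\<close>

text \<open>A sequent is read as the \<open>Par\<close> of its formulae: it is valid if all the
  lists obtained here are cut-free derivable.\<close>

primrec refutations :: "'s subexp_sig \<Rightarrow> 's scll_fm list \<Rightarrow> 's scll_fm list set" where
  "refutations S [] = {[]}"
| "refutations S (A # \<Gamma>) = conc (orth S (interp S A)) (refutations S \<Gamma>)"

lemma conc_assoc: "conc (conc X Y) Z = conc X (conc Y Z)"
  by (simp add: conc_def set_eq_iff) (metis append_assoc)

lemma conc_Nil [simp]: "conc {[]} X = X" "conc X {[]} = X"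
  by (auto simp: conc_def)

lemma refutations_append [simp]: "refutations S (\<Gamma> @ \<Delta>) = conc (refutations S \<Gamma>) (refutations S \<Delta>)"
  by (induction \<Gamma>) (auto simp: conc_assoc)

lemma concE:
  assumes "z \<in> conc X Y" obtains x y where "z = x @ y" "x \<in> X" "y \<in> Y"
  using assms by (auto simp: conc_def)

text \<open>Reduces a one-premise rule to an inclusion of facts: refutations of the conclusion
  already refute the premise.\<close>

lemma refutations_mono:
  assumes "interp S B \<subseteq> interp S A"
  shows "refutations S ([A] @ \<Gamma>) \<subseteq> refutations S ([B] @ \<Gamma>)"
  using orth_antimono[OF assms] by (auto elim!: concE intro!: concI)

text \<open>Here and in the next two lemmas the labels in \<open>x\<close> lie above
  \<open>s\<close>, so upward closure gives each of them the structural rule of \<open>s\<close>,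
  which is then applied formula by formula.\<close>

lemma scll_weak_list:
  assumes S: "subexp_signature S" and s: "s \<in> weak_labels S"
  shows "x \<in> whynot_ctxts S s \<Longrightarrow> SCLL S y \<Longrightarrow> SCLL S (x @ y)"
proof (induction x)
  case (Cons F x)
  then obtain t A where "F = WhyNot t A" "(s, t) \<in> label_le S" "A \<in> scll_fms S"
    "x \<in> whynot_ctxts S s" by (auto simp: whynot_ctxts_def)
  moreover have "t \<in> weak_labels S"
    using S s calculation by (auto simp: subexp_signature_def up_closed_def)
  ultimately show ?case using Cons scll_derivable.weak[of S False "x @ y" t A] by auto
qed simp

lemma scll_ncontr_list:
  assumes S: "subexp_signature S" and s: "s \<in> contr_labels S"
  shows "x \<in> whynot_ctxts S s \<Longrightarrow> SCLL S (x @ y @ x @ z) \<Longrightarrow> SCLL S (x @ y @ z)"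
proof (induction x arbitrary: y z)
  case (Cons F x)
  then obtain t A where F: "F = WhyNot t A" "(s, t) \<in> label_le S" "A \<in> scll_fms S"
    and x: "x \<in> whynot_ctxts S s" by (auto simp: whynot_ctxts_def)
  have t: "t \<in> contr_labels S"
    using S s F by (auto simp: subexp_signature_def up_closed_def)
  have "SCLL S ([WhyNot t A] @ (x @ y) @ [WhyNot t A] @ (x @ z))"
    using Cons.prems F by simp
  then have "SCLL S ([WhyNot t A] @ (x @ y) @ (x @ z))" using t by (rule scll_derivable.ncontr)
  \<comment> \<open>Rotating the contracted head to the end brings the two copies of the tail into
    the shape of the induction hypothesis.\<close>
  then have "SCLL S ((x @ y @ x @ z) @ [WhyNot t A])"
    using scll_rotate_iff[of S False "[WhyNot t A]"] by simp
  then have "SCLL S (x @ y @ z @ [WhyNot t A])" using Cons.IH[OF x, of y "z @ [WhyNot t A]"] by simp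
  then show ?case using scll_derivable.rotate[of S False "x @ y @ z" "[WhyNot t A]"] F by simp
qed simp

lemma scll_ex_list:
  assumes S: "subexp_signature S" and s: "s \<in> exch_labels S"
  shows "x \<in> whynot_ctxts S s \<Longrightarrow> SCLL S (y @ x @ z) \<Longrightarrow> SCLL S (x @ y @ z)"
proof (induction x arbitrary: y z)
  case (Cons F x)
  then obtain t A where F: "F = WhyNot t A" "(s, t) \<in> label_le S" "A \<in> scll_fms S"
    and x: "x \<in> whynot_ctxts S s" by (auto simp: whynot_ctxts_def)
  have t: "t \<in> exch_labels S"
    using S s F by (auto simp: subexp_signature_def up_closed_def)
  \<comment> \<open>The tail crosses \<open>y\<close> and the head first; the head then moves in
    front of both, which restores the order inside the block.\<close>
  have "SCLL S (x @ (y @ [F]) @ z)" using Cons.IH[OF x, of "y @ [F]"] Cons.prems by simp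
  then have "SCLL S ((x @ y) @ [WhyNot t A] @ z)" using F by simp
  then show ?case using t F scll_derivable.ex by fastforce
qed simp

text \<open>Needed for the rule \<open>top\<close>, whose context must be over the signature. A
  refutation \<open>g\<close> of \<open>A\<close> lies in the fact of \<open>neg A\<close>, so
  adequacy makes \<open>neg A, g\<close> derivable.\<close>

lemma refutations_fms:
  assumes "subexp_signature S"
  shows "set \<Gamma> \<subseteq> scll_fms S \<Longrightarrow> x \<in> refutations S \<Gamma> \<Longrightarrow> set x \<subseteq> scll_fms S"
proof (induction \<Gamma> arbitrary: x)
  case (Cons A \<Gamma>)
  then obtain g h where x: "x = g @ h" "g \<in> orth S (interp S A)" "h \<in> refutations S \<Gamma>"
    by (auto elim: concE)
  have "interp S (neg A) \<subseteq> orth S {[neg A]}"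
    using interp_subset_orth[OF assms, of "neg A"] Cons.prems by simp
  then have "SCLL S ([neg A] @ g)" using x by (auto simp: interp_neg in_orth_singleton)
  then have "set ([neg A] @ g) \<subseteq> scll_fms S" by (rule scll_derivable_fms[OF assms])
  then show ?case using x Cons by auto
qed simp

text \<open>By biorthogonality, the refutations of \<open>?\<^sup>t A\<close> may be assumed to be lists of
  \<open>?\<close>-formulae.\<close>

lemma whynot_list_reduce:
  assumes "z \<in> refutations S (map (\<lambda>(t, A). WhyNot t A) tAs)"
    and "\<forall>(t, A) \<in> set tAs. (s, t) \<in> label_le S" and "trans (label_le S)"
    and "\<And>x. x \<in> refutations S (map (\<lambda>(t, A). WhyNot t A) tAs) \<Longrightarrow> x \<in> whynot_ctxts S s \<Longrightarrow> SCLL S (y @ x)"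
  shows "SCLL S (y @ z)"
  using assms(1,2,4)
proof (induction tAs arbitrary: y z)
  case (Cons tA tAs)
  obtain t A where tA: "tA = (t, A)" by force
  let ?X = "whynot_ctxts S t \<inter> orth S (interp S A)"
  obtain g h where z: "z = g @ h" and g: "g \<in> orth S (orth S ?X)"
    and h: "h \<in> refutations S (map (\<lambda>(t, A). WhyNot t A) tAs)"
    using Cons.prems(1) tA by (auto elim: concE)
  \<comment> \<open>A generator \<open>g'\<close> is absorbed into \<open>y\<close> while the tail
    is reduced; afterwards \<open>biorth_cut\<close> replaces it by \<open>g\<close>.\<close>
  have "SCLL S (g' @ (h @ y))" if g': "g' \<in> ?X" for g'
  proof -
    have "SCLL S ((y @ g') @ h)"
    proof (rule Cons.IH[OF h])
      fix x assume x: "x \<in> refutations S (map (\<lambda>(t, A). WhyNot t A) tAs)" "x \<in> whynot_ctxts S s"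
      have "g' \<in> whynot_ctxts S s"
        using g' Cons.prems(2) tA whynot_ctxts_mono[OF _ assms(3)] by auto
      then have "g' @ x \<in> whynot_ctxts S s" using x by (simp add: whynot_ctxts_def)
      moreover have "g' @ x \<in> refutations S (map (\<lambda>(t, A). WhyNot t A) (tA # tAs))"
        using x g' tA subset_biorth by (fastforce intro: concI)
      ultimately show "SCLL S ((y @ g') @ x)" using Cons.prems(3) by simp
    qed (use Cons.prems in auto)
    then show ?thesis using scll_rotate_iff[of S False y] by simp
  qed
  then have "SCLL S (g @ h @ y)" by (rule biorth_cut[OF g])
  then show ?case using z scll_rotate_iff[of S False y] by simp
qed (simp add: whynot_ctxts_def)

text \<open>The conclusion is cut-free for either value of \<open>c\<close>: a cut is absorbed by
  the orthogonality between a fact and its negation. Refutations of the principal formula are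
  reduced to generators wherever they form a closure.\<close>

lemma scll_sound:
  assumes S: "subexp_signature S" and "scll_derivable S c \<Gamma>"
  shows "z \<in> refutations S \<Gamma> \<Longrightarrow> SCLL S z"
  using assms(2)
proof (induction arbitrary: z rule: scll_derivable.induct)
  case (rotate \<Gamma>1 \<Gamma>2)
  then obtain x y where "z = x @ y" "y @ x \<in> refutations S (\<Gamma>1 @ \<Gamma>2)"
    by (auto elim!: concE intro: concI)
  then show ?case using rotate.IH scll_derivable.rotate by blast
next
  case (ax A)
  then obtain x y where z: "z = x @ y" and "x \<in> orth S (interp S A)" "y \<in> interp S A"
    by (auto simp: interp_neg elim!: concE)
  then have "SCLL S (y @ x)" by (simp add: orth_def)
  then show ?case unfolding z by (rule scll_derivable.rotate)
next
  case (tensor \<Gamma> A B \<Delta>)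
  then obtain x y g where z: "z = x @ g @ y" and x: "x \<in> refutations S \<Gamma>"
    and y: "y \<in> refutations S \<Delta>" and g: "g \<in> orth S (conc (interp S B) (interp S A))"
    by (auto elim!: concE)
  \<comment> \<open>The induction hypothesis makes \<open>x\<close> derivable next to every
    refutation of \<open>A\<close>, hence \<open>x\<close> belongs to the fact of
    \<open>A\<close>.\<close>
  have "x \<in> interp S A"
    using tensor.IH(1) x by (auto intro!: in_interpI concI scll_derivable.rotate[of S False x])
  moreover have "y \<in> interp S B"
    using tensor.IH(2) y by (auto intro!: in_interpI concI)
  ultimately have "y @ x \<in> conc (interp S B) (interp S A)" by (intro concI)
  then have "SCLL S ((y @ x) @ g)" using g unfolding orth_def by blast
  then show ?case using scll_rotate_iff[of S False y "x @ g"] z by simp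
next
  case (par A B \<Gamma>)
  then obtain x g where z: "z = g @ x" and x: "x \<in> refutations S \<Gamma>"
    and g: "g \<in> orth S (orth S (conc (orth S (interp S A)) (orth S (interp S B))))"
    by (auto elim!: concE)
  from g show ?case unfolding z
    by (rule biorth_cut) (use par.IH x in \<open>auto elim!: concE simp: concI\<close>)
next
  case (with_rule A1 \<Gamma> A2)
  then obtain x g where z: "z = g @ x" and x: "x \<in> refutations S \<Gamma>"
    and g: "g \<in> orth S (interp S A1 \<inter> interp S A2)"
    by (auto elim!: concE)
  \<comment> \<open>In this form \<open>g\<close> lies in the closure of a union, and may be assumed
    to refute one of the two conjuncts.\<close>
  have "interp S A1 \<inter> interp S A2 = orth S (orth S (interp S A1) \<union> orth S (interp S A2))"
    by (simp add: orth_Un)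
  then have "g \<in> orth S (orth S (orth S (interp S A1) \<union> orth S (interp S A2)))" using g by simp
  then show ?case unfolding z
    by (rule biorth_cut) (use with_rule.IH x in \<open>auto intro: concI\<close>)
next
  case (plus1 A1 \<Gamma> A2)
  have "interp S A1 \<subseteq> interp S (Plus A1 A2)" using subset_biorth[of "interp S A1 \<union> interp S A2"] by simp
  then show ?case using plus1.IH plus1.prems refutations_mono by blast
next
  case (plus2 A2 \<Gamma> A1)
  have "interp S A2 \<subseteq> interp S (Plus A1 A2)" using subset_biorth[of "interp S A1 \<union> interp S A2"] by simp
  then show ?case using plus2.IH plus2.prems refutations_mono by blast
next
  case one
  then have "z \<in> orth S {[]}" by simp
  then show ?case by (simp add: in_orth_singleton)
next
  case (bot \<Gamma>)
  then obtain x g where z: "z = g @ x" and x: "x \<in> refutations S \<Gamma>"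
    and g: "g \<in> orth S (orth S {[]})"
    by (auto elim!: concE)
  from g show ?case unfolding z by (rule biorth_cut) (use bot.IH x in auto)
next
  case (top \<Gamma>)
  then obtain x g where z: "z = g @ x" and x: "x \<in> refutations S \<Gamma>"
    and g: "g \<in> orth S (orth S {[Top]})"
    by (auto elim!: concE)
  \<comment> \<open>The generator of the closure is \<open>[Top]\<close>, so the axiom for
    \<open>Top\<close> applies once \<open>x\<close> is known to be over the signature.\<close>
  have "SCLL S ([Top] @ x)" using refutations_fms[OF S top.hyps x] by (rule scll_derivable.top)
  with g show ?case unfolding z by (auto intro: biorth_cut)
next
  case (ofcourse B tAs s)
  then obtain x g where z: "z = g @ x"
    and x: "x \<in> refutations S (map (\<lambda>(t, A). WhyNot t A) tAs)"
    and g: "g \<in> orth S (whynot_ctxts S s \<inter> interp S B)"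
    by (auto elim!: concE)
  have "trans (label_le S)" using S by (simp add: subexp_signature_def preorder_on_def)
  from x ofcourse.hyps(3) this show ?case unfolding z
  proof (rule whynot_list_reduce)
    fix x assume x: "x \<in> refutations S (map (\<lambda>(t, A). WhyNot t A) tAs)" "x \<in> whynot_ctxts S s"
    \<comment> \<open>Being also a context for \<open>s\<close>, such an \<open>x\<close> generates
      the fact of \<open>OfCourse s B\<close>, to which \<open>g\<close> is orthogonal.\<close>
    have "x \<in> interp S B"
      using ofcourse.IH x by (auto intro!: in_interpI concI)
    then have "SCLL S (x @ g)" using g x by (simp add: orth_def)
    then show "SCLL S (g @ x)" by (rule scll_derivable.rotate)
  qed
next
  case (whynot A \<Gamma> s)
  have "interp S A \<subseteq> interp S (WhyNot s A)" by (simp add: orth_sym[of "interp S A"])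
  then show ?case using whynot.IH whynot.prems refutations_mono by blast
next
  case (weak \<Gamma> s A)
  then obtain x g where z: "z = g @ x" and x: "x \<in> refutations S \<Gamma>"
    and g: "g \<in> orth S (orth S (whynot_ctxts S s \<inter> orth S (interp S A)))"
    by (auto elim!: concE)
  from g show ?case unfolding z
    by (rule biorth_cut) (use weak x scll_weak_list[OF S] in auto)
next
  case (ncontr s A \<Gamma> \<Delta>)
  let ?X = "whynot_ctxts S s \<inter> orth S (interp S A)"
  obtain x y g where z: "z = g @ x @ y" and x: "x \<in> refutations S \<Gamma>"
    and y: "y \<in> refutations S \<Delta>" and g: "g \<in> orth S (orth S ?X)"
    using ncontr.prems by (auto elim!: concE)
  \<comment> \<open>Contraction is available only for lists of \<open>WhyNot\<close> formulae, hence
    the passage to generators: \<open>g'\<close> refutes both copies and is then contracted.\<close>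
  have "SCLL S (g' @ x @ y)" if "g' \<in> ?X" for g'
  proof -
    have "g' \<in> orth S (orth S ?X)" using that subset_biorth by blast
    then have "SCLL S (g' @ x @ g' @ y)" using ncontr.IH x y by (simp add: concI)
    then show ?thesis using scll_ncontr_list[OF S ncontr.hyps(2)] that by blast
  qed
  then show ?case unfolding z by (rule biorth_cut[OF g])
next
  case (ex \<Gamma> s A \<Delta>)
  let ?X = "whynot_ctxts S s \<inter> orth S (interp S A)"
  obtain x y g where z: "z = g @ x @ y" and x: "x \<in> refutations S \<Gamma>"
    and y: "y \<in> refutations S \<Delta>" and g: "g \<in> orth S (orth S ?X)"
    using ex.prems by (auto elim!: concE)
  have "SCLL S (g' @ x @ y)" if "g' \<in> ?X" for g'
  proof -
    have "g' \<in> orth S (orth S ?X)" using that subset_biorth by blast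
    then have "SCLL S (x @ g' @ y)" using ex.IH x y by (simp add: concI)
    then show ?thesis using scll_ex_list[OF S ex.hyps(2)] that by blast
  qed
  then show ?case unfolding z by (rule biorth_cut[OF g])
next
  case (cut \<Gamma> A \<Delta>)
  then obtain x y where z: "z = x @ y" and x: "x \<in> refutations S \<Gamma>" and y: "y \<in> refutations S \<Delta>"
    by (auto elim!: concE)
  have "y \<in> interp S A"
    using cut.IH(2) y by (auto intro!: in_interpI concI)
  \<comment> \<open>The fact of \<open>A\<close> is the set of refutations of \<open>neg A\<close>,
    so \<open>y\<close> can stand for the cut formula of the first premise.\<close>
  then have "x @ y \<in> refutations S (\<Gamma> @ [neg A])" using x by (simp add: interp_neg concI)
  then show ?case unfolding z by (rule cut.IH(1))
qed

text \<open>By adequacy each formula refutes itself, so the sequent is one of its own refutations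
  and soundness applies to it.\<close>

theorem scll_cut_elimination:
  assumes S: "subexp_signature S" and "scll_derivable S c \<Gamma>"
  shows "SCLL S \<Gamma>"
proof (rule scll_sound[OF assms])
  have "set \<Gamma> \<subseteq> scll_fms S \<Longrightarrow> \<Gamma> \<in> refutations S \<Gamma>"
  proof (induction \<Gamma>)
    case (Cons A \<Gamma>)
    have "[A] \<in> orth S (interp S A)"
      using interp_subset_orth[OF S, of A] orth_sym[of "{[A]}"] Cons.prems by auto
    then show ?case using Cons concI by fastforce
  qed simp
  then show "\<Gamma> \<in> refutations S \<Gamma>" using scll_derivable_fms[OF assms] by blast
qed

subsection \<open>From the Lambek calculus to cyclic linear logic\<close>

lemma scll_rotate3:
  "scll_derivable S c (\<Gamma>2 @ \<Delta> @ \<Gamma>1 @ [C]) \<longleftrightarrow> scll_derivable S c (\<Delta> @ \<Gamma>1 @ [C] @ \<Gamma>2)"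
  using scll_rotate_iff[of S c \<Gamma>2 "\<Delta> @ \<Gamma>1 @ [C]"] by simp

text \<open>Left rules become rules for the negated formula. The translation reverses the
  antecedent, and rotation brings the principal formula to the place where the cyclic rule expects
  it.\<close>

lemma smalc_imp_scll:
  "smalc_derivable S c \<Gamma> C \<Longrightarrow> scll_derivable S c (neg_hat_seq \<Gamma> @ [hat C])"
proof (induction rule: smalc_derivable.induct)
  case (ax A)
  then show ?case using scll_derivable.ax[of "neg (hat A)" S c] by simp
next
  case unit_right
  then show ?case by (simp add: scll_derivable.one)
next
  case (dot_left \<Gamma>1 A B \<Gamma>2 C)
  then show ?case
    using scll_derivable.par[of S c "neg (hat B)" "neg (hat A)" "neg_hat_seq \<Gamma>1 @ [hat C] @ neg_hat_seq \<Gamma>2"]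
      scll_rotate3[of S c "neg_hat_seq \<Gamma>2" "[neg (hat B), neg (hat A)]"]
      scll_rotate3[of S c "neg_hat_seq \<Gamma>2" "[Par (neg (hat B)) (neg (hat A))]"] by simp
next
  case (dot_right \<Gamma>1 A \<Gamma>2 B)
  have "scll_derivable S c ([hat B] @ neg_hat_seq \<Gamma>2)"
    using dot_right.IH(2) by (rule scll_derivable.rotate)
  with dot_right.IH(1) have "scll_derivable S c ((neg_hat_seq \<Gamma>1 @ [Tensor (hat A) (hat B)]) @ neg_hat_seq \<Gamma>2)"
    using scll_derivable.tensor by fastforce
  then show ?case using scll_derivable.rotate by fastforce
next
  case (under_left \<Theta> A \<Gamma>1 B \<Gamma>2 C)
  have 1: "scll_derivable S c ([hat A] @ neg_hat_seq \<Theta>)"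
    using under_left.IH(1) by (rule scll_derivable.rotate)
  have "scll_derivable S c ((neg_hat_seq \<Gamma>1 @ [hat C] @ neg_hat_seq \<Gamma>2) @ [neg (hat B)])"
    using under_left.IH(2) scll_rotate_iff[of S c "neg_hat_seq \<Gamma>2 @ [neg (hat B)]"] by simp
  \<comment> \<open>The negated translation of \<open>Under A B\<close> is the tensor of
    \<open>neg (hat B)\<close> and \<open>hat A\<close>.\<close>
  from scll_derivable.tensor[OF this 1] show ?case
    using scll_rotate_iff[of S c "neg_hat_seq \<Gamma>1 @ [hat C]"] by simp
next
  case (under_right A \<Theta> B)
  have "scll_derivable S c ([neg (hat A), hat B] @ neg_hat_seq \<Theta>)"
    using under_right.IH scll_rotate_iff[of S c "neg_hat_seq \<Theta>"] by simp
  then show ?case using scll_derivable.par scll_derivable.rotate by fastforce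
next
  case (over_left \<Theta> A \<Gamma>1 B \<Gamma>2 C)
  have "scll_derivable S c ([neg (hat B)] @ neg_hat_seq \<Gamma>1 @ [hat C] @ neg_hat_seq \<Gamma>2)"
    using over_left.IH(2) scll_rotate_iff[of S c "neg_hat_seq \<Gamma>2"] by simp
  from scll_derivable.tensor[OF over_left.IH(1) this] show ?case
    using scll_rotate_iff[of S c "neg_hat_seq \<Gamma>2"] by simp
next
  case (over_right \<Theta> A B)
  have "scll_derivable S c ([hat B, neg (hat A)] @ neg_hat_seq \<Theta>)"
    using over_right.IH scll_rotate_iff[of S c "neg (hat A) # neg_hat_seq \<Theta>" "[hat B]"] by simp
  then show ?case using scll_derivable.par scll_derivable.rotate by fastforce
next
  case (unit_left \<Gamma>1 \<Gamma>2 C)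
  then show ?case
    using scll_derivable.bot[of S c "neg_hat_seq \<Gamma>1 @ [hat C] @ neg_hat_seq \<Gamma>2"]
    by (simp add: scll_rotate_iff[of S c "neg_hat_seq \<Gamma>2"])
next
  case (join_left \<Gamma>1 A1 \<Gamma>2 C A2)
  then show ?case
    using scll_derivable.with_rule[of S c _ "neg_hat_seq \<Gamma>1 @ [hat C] @ neg_hat_seq \<Gamma>2"]
    by (simp add: scll_rotate_iff[of S c "neg_hat_seq \<Gamma>2"])
next
  case (join_right1 \<Gamma> A1 A2)
  then show ?case using scll_derivable.plus1[of S c "hat A1"]
    by (simp add: scll_rotate_iff[of S c "neg_hat_seq \<Gamma>"])
next
  case (join_right2 \<Gamma> A2 A1)
  then show ?case using scll_derivable.plus2[of S c "hat A2"]
    by (simp add: scll_rotate_iff[of S c "neg_hat_seq \<Gamma>"])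
next
  case (meet_left1 \<Gamma>1 A1 \<Gamma>2 C A2)
  then show ?case
    using scll_derivable.plus1[of S c _ "neg_hat_seq \<Gamma>1 @ [hat C] @ neg_hat_seq \<Gamma>2"]
    by (simp add: scll_rotate_iff[of S c "neg_hat_seq \<Gamma>2"])
next
  case (meet_left2 \<Gamma>1 A2 \<Gamma>2 C A1)
  then show ?case
    using scll_derivable.plus2[of S c _ "neg_hat_seq \<Gamma>1 @ [hat C] @ neg_hat_seq \<Gamma>2"]
    by (simp add: scll_rotate_iff[of S c "neg_hat_seq \<Gamma>2"])
next
  case (meet_right \<Gamma> A1 A2)
  then show ?case using scll_derivable.with_rule[of S c "hat A1"]
    by (simp add: scll_rotate_iff[of S c "neg_hat_seq \<Gamma>"])
next
  case (bang_left \<Gamma>1 A \<Gamma>2 C s)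
  then show ?case
    using scll_derivable.whynot[of S c _ "neg_hat_seq \<Gamma>1 @ [hat C] @ neg_hat_seq \<Gamma>2"]
    by (simp add: scll_rotate_iff[of S c "neg_hat_seq \<Gamma>2"])
next
  case (bang_right tAs B s)
  let ?tAs = "rev (map (\<lambda>(t, A). (t, neg (hat A))) tAs)"
  \<comment> \<open>Reversal keeps the shape demanded by \<open>ofcourse\<close> and leaves the set
    of labels unchanged.\<close>
  have *: "neg_hat_seq (map (\<lambda>(t, A). Bang t A) tAs) = map (\<lambda>(t, A). WhyNot t A) ?tAs"
    by (induction tAs) auto
  have "scll_derivable S c ([hat B] @ map (\<lambda>(t, A). WhyNot t A) ?tAs)"
    using bang_right.IH unfolding * by (rule scll_derivable.rotate)
  then have "scll_derivable S c ([OfCourse s (hat B)] @ map (\<lambda>(t, A). WhyNot t A) ?tAs)"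
    by (rule scll_derivable.ofcourse) (use bang_right.hyps in auto)
  then show ?case unfolding * by (simp add: scll_rotate_iff[of S c _ "[_]", simplified])
next
  case (weak \<Gamma>1 \<Gamma>2 C s A)
  then show ?case
    using scll_derivable.weak[of S c "neg_hat_seq \<Gamma>1 @ [hat C] @ neg_hat_seq \<Gamma>2" s "neg (hat A)"]
    by (simp add: scll_rotate_iff[of S c "neg_hat_seq \<Gamma>2"])
next
  case (ncontr1 \<Gamma>1 s A \<Delta> \<Gamma>2 C)
  let ?F = "WhyNot s (neg (hat A))"
  \<comment> \<open>The cycle is opened at the copy to be kept, so the single cyclic rule covers
    both contraction rules.\<close>
  have "scll_derivable S c ([?F] @ (neg_hat_seq \<Gamma>1 @ [hat C] @ neg_hat_seq \<Gamma>2) @ [?F] @ neg_hat_seq \<Delta>)"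
    using ncontr1.IH scll_rotate_iff[of S c "neg_hat_seq \<Gamma>2 @ [?F] @ neg_hat_seq \<Delta>"] by simp
  from scll_derivable.ncontr[OF this ncontr1.hyps(2)] show ?case
    using scll_rotate_iff[of S c "neg_hat_seq \<Gamma>2 @ neg_hat_seq \<Delta>"] by simp
next
  case (ncontr2 \<Gamma>1 s A \<Delta> \<Gamma>2 C)
  let ?F = "WhyNot s (neg (hat A))"
  have "scll_derivable S c ([?F] @ neg_hat_seq \<Delta> @ [?F] @ neg_hat_seq \<Gamma>1 @ [hat C] @ neg_hat_seq \<Gamma>2)"
    using ncontr2.IH scll_rotate_iff[of S c "neg_hat_seq \<Gamma>2"] by simp
  from scll_derivable.ncontr[OF this ncontr2.hyps(2)] show ?case
    using scll_rotate_iff[of S c "neg_hat_seq \<Gamma>2"] by simp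
next
  case (ex1 \<Gamma>1 \<Delta> s A \<Gamma>2 C)
  let ?F = "WhyNot s (neg (hat A))"
  \<comment> \<open>In the reversed list the formula must move right past \<open>\<Delta>\<close>;
    on the cycle this is a move left past everything else.\<close>
  have "scll_derivable S c ((neg_hat_seq \<Gamma>1 @ [hat C] @ neg_hat_seq \<Gamma>2) @ [?F] @ neg_hat_seq \<Delta>)"
    using ex1.IH scll_rotate_iff[of S c "neg_hat_seq \<Gamma>2 @ [?F] @ neg_hat_seq \<Delta>"] by simp
  from scll_derivable.ex[OF this ex1.hyps(2)] show ?case
    using scll_rotate_iff[of S c "neg_hat_seq \<Gamma>2 @ neg_hat_seq \<Delta>"] by simp
next
  case (ex2 \<Gamma>1 s A \<Delta> \<Gamma>2 C)
  let ?F = "WhyNot s (neg (hat A))"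
  have "scll_derivable S c (neg_hat_seq \<Delta> @ [?F] @ neg_hat_seq \<Gamma>1 @ [hat C] @ neg_hat_seq \<Gamma>2)"
    using ex2.IH scll_rotate_iff[of S c "neg_hat_seq \<Gamma>2"] by simp
  from scll_derivable.ex[OF this ex2.hyps(2)] show ?case
    using scll_rotate_iff[of S c "neg_hat_seq \<Gamma>2"] by simp
next
  case (cut \<Theta> A \<Gamma>1 \<Gamma>2 C)
  have 1: "scll_derivable S c ((neg_hat_seq \<Gamma>1 @ [hat C] @ neg_hat_seq \<Gamma>2) @ [neg (hat A)])"
    using cut.IH(2) scll_rotate_iff[of S c "neg_hat_seq \<Gamma>2 @ [neg (hat A)]"] by simp
  have 2: "scll_derivable S c ([hat A] @ neg_hat_seq \<Theta>)"
    using cut.IH(1) by (rule scll_derivable.rotate)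
  from scll_derivable.cut[OF cut.hyps(1) 1 2] show ?case
    using scll_rotate_iff[of S c "neg_hat_seq \<Gamma>1 @ [hat C]"] by simp
qed

subsection \<open>From cyclic linear logic to the Lambek calculus\<close>

text \<open>On the formulae \<open>hat A\<close> and \<open>neg (hat A)\<close> the predicate \<open>out\<close> tells the former from the
  latter; its values on other formulae are irrelevant.\<close>

primrec out :: "'s scll_fm \<Rightarrow> bool" where
  "out (Atom i) = True"
| "out (NAtom i) = False"
| "out One = True"
| "out Bot = False"
| "out Top = True"
| "out Zero = True"
| "out (Tensor A B) = (out A \<and> out B)"
| "out (Par A B) = (out A \<or> out B)"
| "out (With A B) = out A"
| "out (Plus A B) = out A"
| "out (OfCourse s A) = True"
| "out (WhyNot s A) = False"

lemma out_hat [simp]: "out (hat A)" "\<not> out (neg (hat A))"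
  by (induction A) auto

lemma hat_neq_neg_hat [simp]: "hat A \<noteq> neg (hat B)" "neg (hat B) \<noteq> hat A"
  by (metis out_hat)+

lemma neg_eq_iff [simp]: "neg A = neg B \<longleftrightarrow> A = B"
  by (metis neg_neg)

lemma hat_inject [simp]: "hat A = hat B \<longleftrightarrow> A = B"
  by (induction A arbitrary: B; case_tac B; auto)

text \<open>By \<open>intuitD\<close> this set is closed under immediate subformulae, so a cut-free
  proof of a translated sequent stays inside it.\<close>

definition intuit :: "'s scll_fm set" where
  "intuit = range hat \<union> range (\<lambda>A. neg (hat A))"

text \<open>Inversion of the translation. For \<open>Par\<close>, and dually for a negated
  \<open>Tensor\<close>, the connective leaves \<open>Under\<close> and \<open>Over\<close> open;
  the polarity of the components decides.\<close>

lemma hat_eq_iff: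
  "hat A = Tensor X Y \<longleftrightarrow> (\<exists>B C. A = Dot B C \<and> X = hat B \<and> Y = hat C)"
  "hat A = Par X Y \<longleftrightarrow> (\<exists>B C. A = Under B C \<and> X = neg (hat B) \<and> Y = hat C \<or>
     A = Over C B \<and> X = hat C \<and> Y = neg (hat B))"
  "hat A = With X Y \<longleftrightarrow> (\<exists>B C. A = Meet B C \<and> X = hat B \<and> Y = hat C)"
  "hat A = Plus X Y \<longleftrightarrow> (\<exists>B C. A = Join B C \<and> X = hat B \<and> Y = hat C)"
  "hat A = OfCourse s X \<longleftrightarrow> (\<exists>B. A = Bang s B \<and> X = hat B)"
  "hat A \<noteq> WhyNot s X"
  "hat A = One \<longleftrightarrow> A = Unit"
  "hat A \<noteq> Bot" "hat A \<noteq> Top" "hat A \<noteq> Zero"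
  by (cases A; auto)+

lemma neg_hat_eq_iff:
  "neg (hat A) = Tensor X Y \<longleftrightarrow> (\<exists>B C. A = Under B C \<and> X = neg (hat C) \<and> Y = hat B \<or>
     A = Over C B \<and> X = hat B \<and> Y = neg (hat C))"
  "neg (hat A) = Par X Y \<longleftrightarrow> (\<exists>B C. A = Dot B C \<and> X = neg (hat C) \<and> Y = neg (hat B))"
  "neg (hat A) = With X Y \<longleftrightarrow> (\<exists>B C. A = Join B C \<and> X = neg (hat B) \<and> Y = neg (hat C))"
  "neg (hat A) = Plus X Y \<longleftrightarrow> (\<exists>B C. A = Meet B C \<and> X = neg (hat B) \<and> Y = neg (hat C))"
  "neg (hat A) = WhyNot s X \<longleftrightarrow> (\<exists>B. A = Bang s B \<and> X = neg (hat B))"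
  "neg (hat A) \<noteq> OfCourse s X"
  "neg (hat A) = Bot \<longleftrightarrow> A = Unit"
  "neg (hat A) \<noteq> One" "neg (hat A) \<noteq> Top" "neg (hat A) \<noteq> Zero"
  by (cases A; auto)+

lemma intuit_iff: "F \<in> intuit \<longleftrightarrow> (\<exists>A. hat A = F \<or> neg (hat A) = F)"
  by (auto simp: intuit_def)

lemma intuit_hat [simp]: "hat A \<in> intuit" "neg (hat A) \<in> intuit"
  by (auto simp: intuit_def)

text \<open>The polarity clauses exclude a \<open>Tensor\<close> of two negated translations and a
  \<open>Par\<close> of two unnegated ones, the combinations that would upset the count
  below.\<close>

lemma intuitD:
  "Tensor X Y \<in> intuit \<Longrightarrow> X \<in> intuit \<and> Y \<in> intuit \<and> (out X \<or> out Y)"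
  "Par X Y \<in> intuit \<Longrightarrow> X \<in> intuit \<and> Y \<in> intuit \<and> \<not> (out X \<and> out Y)"
  "With X Y \<in> intuit \<Longrightarrow> X \<in> intuit \<and> Y \<in> intuit \<and> out X = out Y"
  "Plus X Y \<in> intuit \<Longrightarrow> X \<in> intuit \<and> Y \<in> intuit \<and> out X = out Y"
  "OfCourse s X \<in> intuit \<Longrightarrow> X \<in> intuit \<and> out X"
  "WhyNot s X \<in> intuit \<Longrightarrow> X \<in> intuit \<and> \<not> out X"
  by (auto simp: intuit_iff hat_eq_iff neg_hat_eq_iff)

lemma Top_notin_intuit: "Top \<notin> intuit"
  by (simp add: intuit_iff hat_eq_iff neg_hat_eq_iff)

lemma out_neg: "A \<in> intuit \<Longrightarrow> out (neg A) \<longleftrightarrow> \<not> out A"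
  by (auto simp: intuit_iff)

text \<open>By \<open>intuitD\<close> every rule preserves the count. Cut is excluded because its
  formula could leave \<open>intuit\<close>, and \<open>Top\<close> lies outside
  \<open>intuit\<close>, so its axiom cannot occur.\<close>

lemma scll_single_out:
  assumes "scll_derivable S c \<Gamma>" "\<not> c" "set \<Gamma> \<subseteq> intuit"
  shows "length (filter out \<Gamma>) = 1"
  using assms
proof (induction rule: scll_derivable.induct)
  case (ax A)
  then show ?case by (simp add: out_neg)
next
  case (tensor \<Gamma> A B \<Delta>)
  then show ?case using intuitD(1)[of A B] by (simp split: if_splits)
next
  case (par A B \<Gamma>)
  then show ?case using intuitD(2)[of A B] by (simp split: if_splits)
next
  case (with_rule A1 \<Gamma> A2)
  then show ?case using intuitD(3)[of A1 A2] by (simp split: if_splits)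
next
  case (plus1 A1 \<Gamma> A2)
  then show ?case using intuitD(4)[of A1 A2] by (simp split: if_splits)
next
  case (plus2 A2 \<Gamma> A1)
  then show ?case using intuitD(4)[of A1 A2] by (simp split: if_splits)
next
  case (top \<Gamma>)
  then show ?case by (simp add: Top_notin_intuit)
next
  case (ofcourse B tAs s)
  then show ?case using intuitD(5)[of s B] by simp
next
  case (whynot A \<Gamma> s)
  then show ?case using intuitD(6)[of s A] by simp
qed simp_all

lemma neg_hat_seq_intuit [simp]: "set (neg_hat_seq \<Gamma>) \<subseteq> intuit" "filter out (neg_hat_seq \<Gamma>) = []"
  by (auto simp: neg_hat_seq_def filter_empty_conv)

lemma neg_hat_seq_eq_Nil [simp]: "neg_hat_seq \<Gamma> = [] \<longleftrightarrow> \<Gamma> = []" "[] = neg_hat_seq \<Gamma> \<longleftrightarrow> \<Gamma> = []"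
  by (auto simp: neg_hat_seq_def)

section \<open>Locating the output formula \<open>hat C\<close> on an opened cycle\<close>

lemma neg_hat_seq_eq_append:
  assumes "neg_hat_seq \<Theta> = \<Gamma> @ \<Delta>"
  obtains \<Theta>1 \<Theta>2 where "\<Theta> = \<Theta>2 @ \<Theta>1" "\<Gamma> = neg_hat_seq \<Theta>1" "\<Delta> = neg_hat_seq \<Theta>2"
proof -
  have "map (\<lambda>A. neg (hat A)) (rev \<Theta>) = \<Gamma> @ \<Delta>" using assms by (simp add: neg_hat_seq_def rev_map)
  then obtain us vs where "rev \<Theta> = us @ vs" "\<Gamma> = map (\<lambda>A. neg (hat A)) us" "\<Delta> = map (\<lambda>A. neg (hat A)) vs"
    by (auto simp: map_eq_append_conv)
  then show thesis using that[of "rev vs" "rev us"]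
    by (metis neg_hat_seq_def rev_append rev_map rev_rev_ident)
qed

lemma neg_hat_seq_eq_Cons:
  assumes "neg_hat_seq \<Theta> = F # \<Delta>"
  obtains \<Theta>' A where "\<Theta> = \<Theta>' @ [A]" "F = neg (hat A)" "\<Delta> = neg_hat_seq \<Theta>'"
  using assms by (cases \<Theta> rule: rev_cases) auto

text \<open>The point of division falls either after or before the output formula, and since the
  translation reverses order, the pieces of \<open>R\<close> or \<open>L\<close> come back
  swapped.\<close>

lemma append_eq_two_sided:
  assumes "\<Gamma> @ \<Delta> = neg_hat_seq L @ [hat C] @ neg_hat_seq R"
  obtains R1 R2 where "R = R2 @ R1" "\<Gamma> = neg_hat_seq L @ [hat C] @ neg_hat_seq R1" "\<Delta> = neg_hat_seq R2"
  | L1 L2 where "L = L2 @ L1" "\<Gamma> = neg_hat_seq L1" "\<Delta> = neg_hat_seq L2 @ [hat C] @ neg_hat_seq R"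
proof -
  consider us where "neg_hat_seq L = \<Gamma> @ us" "\<Delta> = us @ [hat C] @ neg_hat_seq R"
    | us where "\<Gamma> = neg_hat_seq L @ [hat C] @ us" "neg_hat_seq R = us @ \<Delta>"
    using assms by (auto simp: append_eq_append_conv2 append_eq_Cons_conv Cons_eq_append_conv) metis+
  then show thesis
    by cases (auto elim!: neg_hat_seq_eq_append intro: that)
qed

lemma Cons_eq_two_sided:
  assumes "[F] @ \<Gamma> = neg_hat_seq L @ [hat C] @ neg_hat_seq R"
  obtains "F = hat C" "L = []" "\<Gamma> = neg_hat_seq R"
  | L' A where "L = L' @ [A]" "F = neg (hat A)" "\<Gamma> = neg_hat_seq L' @ [hat C] @ neg_hat_seq R"
  using assms by (cases L rule: rev_cases) auto

text \<open>Of the labels only an inclusion is recorded, which is what the side condition of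
  \<open>bang_right\<close> requires.\<close>

lemma neg_hat_seq_eq_whynots:
  assumes "map (\<lambda>(t, A). WhyNot t A) tAs = neg_hat_seq R"
  obtains uBs where "R = map (\<lambda>(t, A). Bang t A) uBs" "fst ` set uBs \<subseteq> fst ` set tAs"
  using assms
proof (induction tAs arbitrary: R thesis)
  case Nil
  then show ?case by (auto intro: Nil.prems(1)[of "[]"])
next
  case (Cons tA tAs)
  obtain R' D where R: "R = R' @ [D]" "WhyNot (fst tA) (snd tA) = neg (hat D)"
    "map (\<lambda>(t, A). WhyNot t A) tAs = neg_hat_seq R'"
    using Cons.prems(2)[symmetric] by (cases tA; auto elim!: neg_hat_seq_eq_Cons)
  obtain uBs where "R' = map (\<lambda>(t, A). Bang t A) uBs" "fst ` set uBs \<subseteq> fst ` set tAs"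
    using Cons.IH R(3) by blast
  moreover obtain B where "D = Bang (fst tA) B"
    using R(2)[symmetric] by (auto simp: neg_hat_eq_iff)
  ultimately show ?case using R(1) by (intro Cons.prems(1)[of "uBs @ [(fst tA, B)]"]) auto
qed

text \<open>Rotating to put \<open>hat C\<close> last gives the translation of \<open>L @ R\<close>
  followed by \<open>hat C\<close>. Allowing any position of \<open>hat C\<close> makes the
  induction pass through \<open>rotate\<close>. A principal formula is either the output, giving a
  right rule, or a negated translation, giving a left rule.\<close>

lemma scll_imp_smalc:
  assumes "scll_derivable S c \<Gamma>" "\<not> c" "\<Gamma> = neg_hat_seq L @ [hat C] @ neg_hat_seq R"
  shows "SMALC S (L @ R) C"
  using assms
proof (induction arbitrary: L C R rule: scll_derivable.induct)
  case (rotate \<Gamma>1 \<Gamma>2)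
  from rotate.prems(2) show ?case
  proof (cases rule: append_eq_two_sided)
    case (1 R1 R2)
    then show ?thesis using rotate.IH[of "L @ R2" C R1] rotate.prems(1) by simp
  next
    case (2 L1 L2)
    then show ?thesis using rotate.IH[of L2 C "L1 @ R"] rotate.prems(1) by simp
  qed
next
  case (ax A)
  from ax.prems(2) have "[A] @ [neg A] = neg_hat_seq L @ [hat C] @ neg_hat_seq R" by simp
  then show ?case
  proof (cases rule: Cons_eq_two_sided)
    case 1
    then obtain "R = [C]" by (cases R rule: rev_cases) auto
    then show ?thesis using 1 ax.hyps by (simp add: smalc_derivable.ax)
  next
    case (2 L' D)
    then have "L' = []" "R = []" "C = D" by (cases L' rule: rev_cases; auto)+
    then show ?thesis using 2 ax.hyps by (simp add: smalc_derivable.ax)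
  qed
next
  case (tensor \<Gamma> A B \<Delta>)
  have out: "length (filter out (\<Gamma> @ [A])) = 1" if "set (\<Gamma> @ [A]) \<subseteq> intuit"
    using tensor.hyps(1) tensor.prems(1) that by (rule scll_single_out)
  have out': "length (filter out ([B] @ \<Delta>)) = 1" if "set ([B] @ \<Delta>) \<subseteq> intuit"
    using tensor.hyps(2) tensor.prems(1) that by (rule scll_single_out)
  from tensor.prems(2) show ?case
  proof (cases rule: append_eq_two_sided)
    case (1 R1 R2)
    obtain R2' D where D: "R2 = R2' @ [D]" "neg (hat D) = Tensor A B" "\<Delta> = neg_hat_seq R2'"
      using 1(3)[symmetric] by (auto elim!: neg_hat_seq_eq_Cons)
    \<comment> \<open>The output already lies in \<open>\<Gamma>\<close>, so by the count the first
      premise has no room for another at \<open>A\<close>; this excludes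
      \<open>Over\<close>.\<close>
    have "\<not> out A" using out 1(2) D(2)  by (auto simp: neg_hat_eq_iff)
    then obtain E G where E: "D = Under E G" "A = neg (hat G)" "B = hat E"
      using D(2) by (auto simp: neg_hat_eq_iff)
    have "SMALC S (L @ [G] @ R1) C"
      using tensor.IH(1)[of L C "[G] @ R1"] tensor.prems(1) 1 E by simp
    moreover have "SMALC S R2' E"
      using tensor.IH(2)[of "[]" E R2'] tensor.prems(1) D E by simp
    ultimately show ?thesis using smalc_derivable.under_left 1 D E by fastforce
  next
    case (2 L1 L2)
    from 2(3) show ?thesis
    proof (cases rule: Cons_eq_two_sided)
      case 1
      then obtain E G where E: "C = Dot E G" "A = hat E" "B = hat G"
        by (metis hat_eq_iff(1))
      have "SMALC S L1 E" "SMALC S R G"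
        using tensor.IH(1)[of L1 E "[]"] tensor.IH(2)[of "[]" G R] tensor.prems(1) 1 2 E by simp_all
      then show ?thesis using smalc_derivable.dot_right 1 2 E by fastforce
    next
      case D: (2 L' D)
      have T: "neg (hat D) = Tensor A B" using D(2) by simp
      \<comment> \<open>Now the output lies in \<open>\<Delta>\<close>, and the count in the second
        premise excludes \<open>Under\<close>.\<close>
      have "\<not> out B" using out' D(3) T by (auto simp: neg_hat_eq_iff)
      then obtain E G where E: "D = Over G E" "A = hat E" "B = neg (hat G)"
        using T by (auto simp: neg_hat_eq_iff)
      have "SMALC S L1 E" "SMALC S (L' @ [G] @ R) C"
        using tensor.IH(1)[of L1 E "[]"] tensor.IH(2)[of "L' @ [G]" C R] tensor.prems(1) D 2 E by simp_all
      then show ?thesis using smalc_derivable.over_left D 2 E by fastforce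
    qed
  qed
next
  case (par A B \<Gamma>)
  from par.prems(2) show ?case
  proof (cases rule: Cons_eq_two_sided)
    case 1
    then consider E G where "C = Under E G" "A = neg (hat E)" "B = hat G"
      | E G where "C = Over G E" "A = hat G" "B = neg (hat E)"
      by (metis hat_eq_iff(2))
    then show ?thesis
    proof cases
      case E: 1
      then show ?thesis using par.IH[of "[E]" G R] par.prems(1) 1
        by (simp add: smalc_derivable.under_right)
    next
      case E: 2
      then show ?thesis using par.IH[of "[]" G "R @ [E]"] par.prems(1) 1
        by (simp add: smalc_derivable.over_right)
    qed
  next
    case D: (2 L' D)
    then obtain E G where E: "D = Dot E G" "A = neg (hat G)" "B = neg (hat E)"
      by (metis neg_hat_eq_iff(2))
    have "SMALC S (L' @ [E, G] @ R) C" using par.IH[of "L' @ [E, G]" C R] par.prems(1) D E by simp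
    then show ?thesis using smalc_derivable.dot_left D E by fastforce
  qed
next
  case (with_rule A1 \<Gamma> A2)
  from with_rule.prems(2) show ?case
  proof (cases rule: Cons_eq_two_sided)
    case 1
    then obtain E G where "C = Meet E G" "A1 = hat E" "A2 = hat G" by (metis hat_eq_iff(3))
    then show ?thesis
      using with_rule.IH(1)[of "[]" E R] with_rule.IH(2)[of "[]" G R] with_rule.prems(1) 1
      by (simp add: smalc_derivable.meet_right)
  next
    case D: (2 L' D)
    then obtain E G where E: "D = Join E G" "A1 = neg (hat E)" "A2 = neg (hat G)"
      by (metis neg_hat_eq_iff(3))
    have "SMALC S (L' @ [E] @ R) C" "SMALC S (L' @ [G] @ R) C"
      using with_rule.IH(1)[of "L' @ [E]" C R] with_rule.IH(2)[of "L' @ [G]" C R]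
        with_rule.prems(1) D E by simp_all
    then show ?thesis using smalc_derivable.join_left D E by fastforce
  qed
next
  case (plus1 A1 \<Gamma> A2)
  from plus1.prems(2) show ?case
  proof (cases rule: Cons_eq_two_sided)
    case 1
    then obtain E G where "C = Join E G" "A1 = hat E" "A2 = hat G" by (metis hat_eq_iff(4))
    then show ?thesis using plus1.IH[of "[]" E R] plus1.prems(1) plus1.hyps(2) 1
      by (simp add: smalc_derivable.join_right1)
  next
    case D: (2 L' D)
    then obtain E G where E: "D = Meet E G" "A1 = neg (hat E)" "A2 = neg (hat G)"
      by (metis neg_hat_eq_iff(4))
    have "SMALC S (L' @ [E] @ R) C" using plus1.IH[of "L' @ [E]" C R] plus1.prems(1) D E by simp
    then show ?thesis using smalc_derivable.meet_left1[of S False L' E R C G] plus1.hyps(2) D E by simp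
  qed
next
  case (plus2 A2 \<Gamma> A1)
  from plus2.prems(2) show ?case
  proof (cases rule: Cons_eq_two_sided)
    case 1
    then obtain E G where "C = Join E G" "A1 = hat E" "A2 = hat G" by (metis hat_eq_iff(4))
    then show ?thesis using plus2.IH[of "[]" G R] plus2.prems(1) plus2.hyps(2) 1
      by (simp add: smalc_derivable.join_right2)
  next
    case D: (2 L' D)
    then obtain E G where E: "D = Meet E G" "A1 = neg (hat E)" "A2 = neg (hat G)"
      by (metis neg_hat_eq_iff(4))
    have "SMALC S (L' @ [G] @ R) C" using plus2.IH[of "L' @ [G]" C R] plus2.prems(1) D E by simp
    then show ?thesis using smalc_derivable.meet_left2[of S False L' G R C E] plus2.hyps(2) D E by simp
  qed
next
  case one
  then have "[One] @ [] = neg_hat_seq L @ [hat C] @ neg_hat_seq R" by simp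
  then show ?case
  proof (cases rule: Cons_eq_two_sided)
    case 1
    then have "C = Unit" by (metis hat_eq_iff(7))
    then show ?thesis using 1 by (simp add: smalc_derivable.unit_right)
  next
    case (2 L' D)
    then show ?thesis by (metis neg_hat_eq_iff(8))
  qed
next
  case (bot \<Gamma>)
  from bot.prems(2) show ?case
  proof (cases rule: Cons_eq_two_sided)
    case 1
    then show ?thesis by (metis hat_eq_iff(8))
  next
    case D: (2 L' D)
    then have "D = Unit" by (metis neg_hat_eq_iff(7))
    then show ?thesis using bot.IH[of L' C R] bot.prems(1) D smalc_derivable.unit_left[of S False L' R C]
      by simp
  qed
next
  case (top \<Gamma>)
  from top.prems(2) show ?case
  proof (cases rule: Cons_eq_two_sided)
    case 1
    then show ?thesis by (metis hat_eq_iff(9))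
  next
    case (2 L' D)
    then show ?thesis by (metis neg_hat_eq_iff(9))
  qed
next
  case (ofcourse B tAs s)
  from ofcourse.prems(2) show ?case
  proof (cases rule: Cons_eq_two_sided)
    case 1
    then obtain E where E: "C = Bang s E" "B = hat E" by (metis hat_eq_iff(5))
    obtain uBs where R: "R = map (\<lambda>(t, A). Bang t A) uBs" "fst ` set uBs \<subseteq> fst ` set tAs"
      using 1(3) by (rule neg_hat_seq_eq_whynots)
    have "SMALC S R E" using ofcourse.IH[of "[]" E R] ofcourse.prems(1) 1 E by simp
    moreover have "\<forall>(t, A)\<in>set uBs. (s, t) \<in> label_le S" using R(2) ofcourse.hyps(3) by fastforce
    ultimately show ?thesis using 1 E R ofcourse.hyps(2) by (simp add: smalc_derivable.bang_right)
  next
    case D: (2 L' D)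
    then show ?thesis by (metis neg_hat_eq_iff(6))
  qed
next
  case (whynot A \<Gamma> s)
  from whynot.prems(2) show ?case
  proof (cases rule: Cons_eq_two_sided)
    case 1
    then show ?thesis by (metis hat_eq_iff(6))
  next
    case D: (2 L' D)
    then obtain E where E: "D = Bang s E" "A = neg (hat E)" by (metis neg_hat_eq_iff(5))
    have "SMALC S (L' @ [E] @ R) C" using whynot.IH[of "L' @ [E]" C R] whynot.prems(1) D E by simp
    then show ?thesis using smalc_derivable.bang_left[of S False L' E R C s] whynot.hyps(2) D E by simp
  qed
next
  case (weak \<Gamma> s A)
  from weak.prems(2) show ?case
  proof (cases rule: Cons_eq_two_sided)
    case 1
    then show ?thesis by (metis hat_eq_iff(6))
  next
    case D: (2 L' D)
    then obtain E where E: "D = Bang s E" "A = neg (hat E)" by (metis neg_hat_eq_iff(5))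
    have "SMALC S (L' @ R) C" using weak.IH[of L' C R] weak.prems(1) D E by simp
    then show ?thesis using smalc_derivable.weak[of S False L' R C s E] weak.hyps D E by simp
  qed
next
  case (ncontr s A \<Gamma> \<Delta>)
  from ncontr.prems(2) show ?case
  proof (cases rule: Cons_eq_two_sided)
    case 1
    then show ?thesis by (metis hat_eq_iff(6))
  next
    case D: (2 L' D)
    then obtain E where E: "D = Bang s E" "A = neg (hat E)" by (metis neg_hat_eq_iff(5))
    \<comment> \<open>The position of the output decides which copy survives: with the output in
      \<open>\<Gamma>\<close> the kept copy becomes the left one, with the output in
      \<open>\<Delta>\<close> the right one.\<close>
    from D(3) show ?thesis
    proof (cases rule: append_eq_two_sided)
      case (1 R1 R2)
      have "SMALC S (L' @ [Bang s E] @ R2 @ [Bang s E] @ R1) C"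
        using ncontr.IH[of "L' @ [Bang s E]" C "R2 @ [Bang s E] @ R1"] ncontr.prems(1) D E 1 by simp
      from smalc_derivable.ncontr1[OF this ncontr.hyps(2)] show ?thesis using D E 1 by simp
    next
      case (2 L1 L2)
      have "SMALC S (L2 @ [Bang s E] @ L1 @ [Bang s E] @ R) C"
        using ncontr.IH[of "L2 @ [Bang s E] @ L1 @ [Bang s E]" C R] ncontr.prems(1) D E 2 by simp
      from smalc_derivable.ncontr2[OF this ncontr.hyps(2)] show ?thesis using D E 2 by simp
    qed
  qed
next
  case (ex \<Gamma> s A \<Delta>)
  from ex.prems(2) show ?case
  proof (cases rule: Cons_eq_two_sided)
    case 1
    then show ?thesis by (metis hat_eq_iff(6))
  next
    case D: (2 L' D)
    then obtain E where E: "D = Bang s E" "A = neg (hat E)" by (metis neg_hat_eq_iff(5))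
    from D(3) show ?thesis
    proof (cases rule: append_eq_two_sided)
      case (1 R1 R2)
      have "SMALC S (L' @ R2 @ [Bang s E] @ R1) C"
        using ex.IH[of L' C "R2 @ [Bang s E] @ R1"] ex.prems(1) D E 1 by simp
      from smalc_derivable.ex1[OF this ex.hyps(2)] show ?thesis using D E 1 by simp
    next
      case (2 L1 L2)
      have "SMALC S (L2 @ [Bang s E] @ L1 @ R) C"
        using ex.IH[of "L2 @ [Bang s E] @ L1" C R] ex.prems(1) D E 2 by simp
      from smalc_derivable.ex2[OF this ex.hyps(2)] show ?thesis using D E 2 by simp
    qed
  qed
qed simp

text \<open>The flag is a fixed parameter of the inductive definition, so each rule is replayed in
  the larger system; the case of cut has the premise \<open>False\<close>.\<close>

lemma smalc_imp_smalc_cut: "SMALC S \<Gamma> C \<Longrightarrow> SMALC_cut S \<Gamma> C"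
proof (induction rule: smalc_derivable.induct)
  case ax
  show ?case by (rule smalc_derivable.ax; fact ax)
next
  case unit_right
  show ?case by (rule smalc_derivable.unit_right)
next
  case dot_left
  show ?case by (rule smalc_derivable.dot_left; fact dot_left)
next
  case dot_right
  show ?case by (rule smalc_derivable.dot_right; fact dot_right)
next
  case under_left
  show ?case by (rule smalc_derivable.under_left; fact under_left)
next
  case under_right
  show ?case by (rule smalc_derivable.under_right; fact under_right)
next
  case over_left
  show ?case by (rule smalc_derivable.over_left; fact over_left)
next
  case over_right
  show ?case by (rule smalc_derivable.over_right; fact over_right)
next
  case unit_left
  show ?case by (rule smalc_derivable.unit_left; fact unit_left)
next
  case join_left
  show ?case by (rule smalc_derivable.join_left; fact join_left)
next
  case join_right1
  show ?case by (rule smalc_derivable.join_right1; fact join_right1)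
next
  case join_right2
  show ?case by (rule smalc_derivable.join_right2; fact join_right2)
next
  case meet_left1
  show ?case by (rule smalc_derivable.meet_left1; fact meet_left1)
next
  case meet_left2
  show ?case by (rule smalc_derivable.meet_left2; fact meet_left2)
next
  case meet_right
  show ?case by (rule smalc_derivable.meet_right; fact meet_right)
next
  case bang_left
  show ?case by (rule smalc_derivable.bang_left; fact bang_left)
next
  case bang_right
  show ?case by (rule smalc_derivable.bang_right; fact bang_right)
next
  case weak
  show ?case by (rule smalc_derivable.weak; fact weak)
next
  case ncontr1
  show ?case by (rule smalc_derivable.ncontr1; fact ncontr1)
next
  case ncontr2
  show ?case by (rule smalc_derivable.ncontr2; fact ncontr2)
next
  case ex1
  show ?case by (rule smalc_derivable.ex1; fact ex1)
next
  case ex2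
  show ?case by (rule smalc_derivable.ex2; fact ex2)
qed simp

theorem theorem2:
  fixes S :: "'s subexp_sig" and As :: "'s smalc_fm list" and B :: "'s smalc_fm"
  assumes "subexp_signature S"
    and "set As \<subseteq> smalc_fms S"
    and "B \<in> smalc_fms S"
  shows "(SMALC S As B \<longleftrightarrow> SMALC_cut S As B) \<and>
    (SMALC_cut S As B \<longleftrightarrow> SCLL_cut S (neg_hat_seq As @ [hat B])) \<and>
    (SCLL_cut S (neg_hat_seq As @ [hat B]) \<longleftrightarrow> SCLL S (neg_hat_seq As @ [hat B]))"
proof -
  \<comment> \<open>The four statements are linked in a cycle, with cut eliminated only in cyclic
    linear logic; cut elimination for the Lambek calculus results from going around it.\<close>
  have "SMALC S As B \<Longrightarrow> SMALC_cut S As B" by (rule smalc_imp_smalc_cut)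
  moreover have "SMALC_cut S As B \<Longrightarrow> SCLL_cut S (neg_hat_seq As @ [hat B])"
    by (rule smalc_imp_scll)
  moreover have "SCLL_cut S (neg_hat_seq As @ [hat B]) \<Longrightarrow> SCLL S (neg_hat_seq As @ [hat B])"
    by (rule scll_cut_elimination[OF assms(1)])
  moreover have "SCLL S (neg_hat_seq As @ [hat B]) \<Longrightarrow> SMALC S As B"
    using scll_imp_smalc[of S False _ As B "[]"] by simp
  ultimately show ?thesis by blast
qed

end
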